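(* Let $G$ be a Wheeler graph with $n$ vertices and a fixed Wheeler order $\pi$, let $r$ be the number of runs in the Burrows-Wheeler Transform $B$ of $G$ according to $\pi$, let $D$ be a decomposition of $G$ into $\upsilon$ edge-disjoint directed paths whose internal vertices each have in-degree exactly 1 and out-degree exactly 1, and let the vertices of $G$ be assigned identifiers compatible with $D$. Let $\phi$ be the function that takes the identifier of a vertex $u$ of $G$ and returns the identifier of the vertex that immediately precedes $u$ in $\pi$ (the value of $\phi$ at the identifier of the first vertex in $\pi$ is unspecified). Then $G$ can be stored in a data structure using $O(r + \upsilon)$ words of space such that $\phi$ can be evaluated in $O(\log \log n)$ time.
   Context: Wheeler graph: a (finite) directed multigraph whose edges are labelled with characters from a totally ordered alphabet and whose vertices can be totally ordered so that the vertices of in-degree 0 precede those of positive in-degree and, for any pair of edges $e = (u,v)$ and $e' = (u',v')$ labelled $a$ and $a'$ respectively: (i) if $a \prec a'$ then $v < v'$; (ii) if $a = a'$ and $u < u'$ then $v \le v'$. Any such order on the vertices is called a Wheeler order. A Wheeler graph may have many Wheeler orders; one, denoted $\pi$, is fixed. Burrows-Wheeler Transform (BWT): the BWT $B$ of $G$ according to $\pi$ is the listing of all the edge labels of $G$ (one entry per edge) such that, for edges $(u,v)$ and $(u',v')$ labelled $a$ and $a'$, if $u < u'$ in $\pi$ then $a$ precedes $a'$ in the listing; the labels of the out-edges of a single vertex are listed in the order in $\pi$ of their destinations. A run in $B$ is a maximal non-empty substring consisting of copies of one character; $r$ is the number of runs in $B$. Decomposition: $D$ is a set of $\upsilon$ edge-disjoint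 directed paths that together make up $G$ (every edge lies on exactly one of the paths, every vertex lies on at least one, and a path consisting of a single vertex is allowed for an isolated vertex), such that each internal vertex of each path has in-degree and out-degree exactly 1 in $G$. The first and last vertices of a path are its endpoints (they may coincide). Identifiers: the vertices have distinct numeric identifiers from $\{0, \ldots, n-1\}$. They are compatible with $D$ if, whenever $(u,v)$ is an edge, neither $u$ nor $v$ is an endpoint of a path in $D$, and $u$ has identifier $i$, then $v$ has identifier $i+1$. The identifiers need not be the ranks of the vertices in $\pi$. Computational model and conventions: word RAM with words of $\Theta(\log n)$ bits; space is measured in words; the number of edges of $G$ is assumed to be polynomial in $n$; the data structure is static and the construction time is not restricted. Asymptotic time bounds are understood up to an additive $O(1)$. The identifiers are part of the given data. *)

theory Defs
  imports Complex_Main "Graph_Theory.Arc_Walk"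
begin

section \<open>Wheeler graphs\<close>

text \<open>
  A vertex order is a reflexive linear order \<open>\<pi>\<close> on \<^term>\<open>verts G\<close>, given as a relation:
  \<open>(u, v) \<in> \<pi>\<close> means that \<open>u\<close> equals or precedes \<open>v\<close>.
\<close>

definition precedes :: "'v rel \<Rightarrow> 'v \<Rightarrow> 'v \<Rightarrow> bool" where
  "precedes \<pi> u v \<longleftrightarrow> (u, v) \<in> \<pi> \<and> u \<noteq> v"

definition wheeler_order ::
  "('v, 'e) pre_digraph \<Rightarrow> ('e \<Rightarrow> 'c::linorder) \<Rightarrow> 'v rel \<Rightarrow> bool" where
  "wheeler_order G lab \<pi> \<longleftrightarrow>
     linear_order_on (verts G) \<pi> \<and>
     (\<forall>u\<in>verts G. \<forall>v\<in>verts G. in_degree G u = 0 \<and> 0 < in_degree G v \<longrightarrow> precedes \<pi> u v) \<and>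
     (\<forall>e\<in>arcs G. \<forall>e'\<in>arcs G.
        (lab e < lab e' \<longrightarrow> precedes \<pi> (head G e) (head G e')) \<and>
        (lab e = lab e' \<and> precedes \<pi> (tail G e) (tail G e') \<longrightarrow> (head G e, head G e') \<in> \<pi>))"

definition wheeler_graph :: "('v, 'e) pre_digraph \<Rightarrow> ('e \<Rightarrow> 'c::linorder) \<Rightarrow> bool" where
  "wheeler_graph G lab \<longleftrightarrow> fin_digraph G \<and> (\<exists>\<pi>. wheeler_order G lab \<pi>)"

section \<open>Burrows-Wheeler Transform\<close>

text \<open>
  Only parallel arcs can be exchanged in the list \<open>es\<close> below. In a Wheeler graph these carry
  the same label, so \<open>B\<close> is uniquely determined.
\<close>

definition is_BWT ::
  "('v, 'e) pre_digraph \<Rightarrow> ('e \<Rightarrow> 'c) \<Rightarrow> 'v rel \<Rightarrow> 'c list \<Rightarrow> bool" where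
  "is_BWT G lab \<pi> B \<longleftrightarrow>
     (\<exists>es. distinct es \<and> set es = arcs G \<and>
        sorted_wrt (\<lambda>e e'. precedes \<pi> (tail G e) (tail G e') \<or>
                      tail G e = tail G e' \<and> (head G e, head G e') \<in> \<pi>) es \<and>
        B = map lab es)"

text \<open>A run is represented by its half-open interval of positions \<open>{i..<j}\<close>.\<close>

definition runs :: "'c list \<Rightarrow> (nat \<times> nat) set" where
  "runs B = {(i, j). i < j \<and> j \<le> length B \<and> (\<forall>k\<in>{i..<j}. B ! k = B ! i) \<and>
                     (0 < i \<longrightarrow> B ! (i - 1) \<noteq> B ! i) \<and> (j < length B \<longrightarrow> B ! j \<noteq> B ! i)}"

section \<open>Path decompositions and identifiers\<close>

text \<open>A path is given by its first vertex and its list of arcs.\<close>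

definition path_verts :: "('v, 'e) pre_digraph \<Rightarrow> 'v \<times> 'e list \<Rightarrow> 'v list" where
  "path_verts G p = pre_digraph.awalk_verts G (fst p) (snd p)"

definition path_endpoints :: "('v, 'e) pre_digraph \<Rightarrow> 'v \<times> 'e list \<Rightarrow> 'v set" where
  "path_endpoints G p = {hd (path_verts G p), last (path_verts G p)}"

definition path_internal :: "('v, 'e) pre_digraph \<Rightarrow> 'v \<times> 'e list \<Rightarrow> 'v set" where
  "path_internal G p = set (butlast (tl (path_verts G p)))"

text \<open>
  No vertex is repeated, except that the two endpoints may coincide. Loops count as
  \<^const>\<open>pre_digraph.cycle\<close>.
\<close>

definition directed_path :: "('v, 'e) pre_digraph \<Rightarrow> 'v \<times> 'e list \<Rightarrow> bool" where
  "directed_path G p \<longleftrightarrow>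
     (\<exists>v. pre_digraph.apath G (fst p) (snd p) v) \<or>
     (pre_digraph.awalk G (fst p) (snd p) (fst p) \<and> pre_digraph.cycle G (snd p))"

definition path_decomposition :: "('v, 'e) pre_digraph \<Rightarrow> ('v \<times> 'e list) set \<Rightarrow> bool" where
  "path_decomposition G D \<longleftrightarrow>
     finite D \<and>
     (\<forall>p\<in>D. directed_path G p) \<and>
     (\<forall>e\<in>arcs G. \<exists>!p. p \<in> D \<and> e \<in> set (snd p)) \<and>
     (\<forall>v\<in>verts G. \<exists>p\<in>D. v \<in> set (path_verts G p)) \<and>
     (\<forall>p\<in>D. snd p = [] \<longrightarrow> in_degree G (fst p) = 0 \<and> out_degree G (fst p) = 0) \<and>
     (\<forall>p\<in>D. \<forall>v\<in>path_internal G p. in_degree G v = 1 \<and> out_degree G v = 1)"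

definition identifiers :: "('v, 'e) pre_digraph \<Rightarrow> ('v \<Rightarrow> nat) \<Rightarrow> bool" where
  "identifiers G ident \<longleftrightarrow>
     inj_on ident (verts G) \<and> ident ` verts G \<subseteq> {0..<card (verts G)}"

definition compatible_identifiers ::
  "('v, 'e) pre_digraph \<Rightarrow> ('v \<times> 'e list) set \<Rightarrow> ('v \<Rightarrow> nat) \<Rightarrow> bool" where
  "compatible_identifiers G D ident \<longleftrightarrow>
     (\<forall>e\<in>arcs G.
        tail G e \<notin> (\<Union>p\<in>D. path_endpoints G p) \<and> head G e \<notin> (\<Union>p\<in>D. path_endpoints G p) \<longrightarrow>
        ident (head G e) = ident (tail G e) + 1)"

section \<open>The function \<open>\<phi>\<close>\<close>

definition immediately_precedes :: "'v rel \<Rightarrow> 'v \<Rightarrow> 'v \<Rightarrow> bool" where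
  "immediately_precedes \<pi> u v \<longleftrightarrow>
     precedes \<pi> u v \<and> \<not> (\<exists>x. precedes \<pi> u x \<and> precedes \<pi> x v)"

text \<open>The value at the identifier of the first vertex is unspecified.\<close>

definition phi :: "('v, 'e) pre_digraph \<Rightarrow> 'v rel \<Rightarrow> ('v \<Rightarrow> nat) \<Rightarrow> nat \<Rightarrow> nat" where
  "phi G \<pi> ident i =
     (THE j. \<exists>u\<in>verts G. \<exists>u'. ident u = i \<and> immediately_precedes \<pi> u' u \<and> j = ident u')"

section \<open>Word RAM\<close>

text \<open>
  A machine with \<open>w\<close>-bit words: registers and memory cells hold numbers below \<open>2 ^ w\<close>, and all
  arithmetic is modulo \<open>2 ^ w\<close> (with \<open>x div 0 = 0\<close> and \<open>x mod 0 = x\<close>). Every instruction costs one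
  time unit. The memory has a fixed number of cells, and there is no transition for an access outside
  of it. Since programs are finite and registers are addressed directly, a program uses a constant
  number of registers.
\<close>

datatype binop =
  OpAdd | OpSub | OpMul | OpDiv | OpMod | OpAnd | OpOr | OpXor | OpShl | OpShr

datatype instr =
    IConst nat nat
  | IBin binop nat nat nat
  | ILoad nat nat
  | IStore nat nat
  | IJump nat
  | IJumpLess nat nat nat
  | IJumpEq nat nat nat

text \<open>Program counter, registers, memory.\<close>

type_synonym config = "nat \<times> (nat \<Rightarrow> nat) \<times> nat list"

context
  includes bit_operations_syntax
begin

fun eval_binop :: "nat \<Rightarrow> binop \<Rightarrow> nat \<Rightarrow> nat \<Rightarrow> nat" where
  "eval_binop w OpAdd x y = (x + y) mod 2 ^ w"
| "eval_binop w OpSub x y = (x + 2 ^ w - y) mod 2 ^ w"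
| "eval_binop w OpMul x y = (x * y) mod 2 ^ w"
| "eval_binop w OpDiv x y = x div y"
| "eval_binop w OpMod x y = x mod y"
| "eval_binop w OpAnd x y = x AND y"
| "eval_binop w OpOr x y = x OR y"
| "eval_binop w OpXor x y = x XOR y"
| "eval_binop w OpShl x y = (x * 2 ^ y) mod 2 ^ w"
| "eval_binop w OpShr x y = x div 2 ^ y"

end

fun exec_instr :: "nat \<Rightarrow> instr \<Rightarrow> config \<Rightarrow> config option" where
  "exec_instr w (IConst a k) (pc, R, M) = Some (pc + 1, R(a := k mod 2 ^ w), M)"
| "exec_instr w (IBin b a x y) (pc, R, M) =
     Some (pc + 1, R(a := eval_binop w b (R x) (R y)), M)"
| "exec_instr w (ILoad a x) (pc, R, M) =
     (if R x < length M then Some (pc + 1, R(a := M ! R x), M) else None)"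
| "exec_instr w (IStore x a) (pc, R, M) =
     (if R x < length M then Some (pc + 1, R, M[R x := R a]) else None)"
| "exec_instr w (IJump l) (pc, R, M) = Some (l, R, M)"
| "exec_instr w (IJumpLess x y l) (pc, R, M) =
     Some (if R x < R y then l else pc + 1, R, M)"
| "exec_instr w (IJumpEq x y l) (pc, R, M) =
     Some (if R x = R y then l else pc + 1, R, M)"

text \<open>The machine halts when the program counter leaves the program.\<close>

definition step :: "nat \<Rightarrow> instr list \<Rightarrow> config \<Rightarrow> config option" where
  "step w P c = (if fst c < length P then exec_instr w (P ! fst c) c else None)"

fun run_steps :: "nat \<Rightarrow> instr list \<Rightarrow> nat \<Rightarrow> config \<Rightarrow> config option" where
  "run_steps w P 0 c = Some c"
| "run_steps w P (Suc t) c = Option.bind (step w P c) (run_steps w P t)"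

text \<open>
  The argument is passed and the result returned in register 0. The final memory must equal the
  initial memory, so that the structure can be queried again.
\<close>

definition answers ::
  "nat \<Rightarrow> instr list \<Rightarrow> nat list \<Rightarrow> nat \<Rightarrow> nat \<Rightarrow> nat \<Rightarrow> bool" where
  "answers w P M x t y \<longleftrightarrow>
     (\<exists>pc R. run_steps w P t (0, (\<lambda>_. 0)(0 := x), M) = Some (pc, R, M) \<and>
             length P \<le> pc \<and> R 0 = y)"

text \<open>
  The arguments are shifted so that the formulas also make sense for \<open>n \<le> 2\<close>; up to constant
  factors, they are \<open>log n\<close> and \<open>log log n + O(1)\<close>.
\<close>

definition lg :: "nat \<Rightarrow> real" where
  "lg n = log 2 (real n + 2)"

definition lglg :: "nat \<Rightarrow> real" where
  "lglg n = log 2 (lg n)"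

text \<open>
  A data structure of at most \<open>s\<close> words of \<open>w\<close> bits from which the program \<open>P\<close> evaluates \<open>\<phi>\<close> in
  at most \<open>T\<close> steps. For the first vertex the program must halt in time, but the
  result is arbitrary.
\<close>

definition supports_phi ::
  "nat \<Rightarrow> instr list \<Rightarrow> real \<Rightarrow> real \<Rightarrow> ('v, 'e) pre_digraph \<Rightarrow> 'v rel \<Rightarrow> ('v \<Rightarrow> nat) \<Rightarrow>
   nat list \<Rightarrow> bool" where
  "supports_phi w P s T G \<pi> ident M \<longleftrightarrow>
     real (length M) \<le> s \<and> (\<forall>x\<in>set M. x < 2 ^ w) \<and>
     (\<forall>u\<in>verts G. \<exists>t y. real t \<le> T \<and> answers w P M (ident u) t y \<and>
        ((\<exists>u'. immediately_precedes \<pi> u' u) \<longrightarrow> y = phi G \<pi> ident (ident u)))"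

end

theory Submission
  imports Defs
begin

text \<open>
  Let \<open>v\<close> be the successor of \<open>u\<close> on a path and \<open>u'\<close> the predecessor of \<open>u\<close> in \<open>\<pi>\<close>. If \<open>u\<close>, \<open>v\<close>, \<open>u'\<close> and
  the successor \<open>v'\<close> of \<open>u'\<close> are not endpoints and the two arcs carry the same label, then \<open>v'\<close>
  immediately precedes \<open>v\<close>, so both identifiers grow by one and \<open>\<phi>(i + 1) = \<phi>(i) + 1\<close>. Each exception is
  charged to an endpoint, a path, the first vertex, or the start of a run. Hence \<open>\<phi>\<close> is determined by
  its values at \<open>O(r + \<upsilon>)\<close> identifiers, and evaluating it is a predecessor search among them.

  For the predecessor search with \<open>k\<close>-bit keys, every \<open>(k + 1)\<close>-th key is inserted into a binary
  trie, whose nodes are kept in a two-level perfect hash table of linear size. Bisection over the depth of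
  the deepest trie node above the query finds a bucket of \<open>k + 1\<close> consecutive keys, and a second
  bisection finishes in the bucket. The hash functions multiply modulo the word size and divide, which
  avoids choosing a prime.
\<close>

section \<open>Perfect hashing\<close>

text \<open>A sample contributes \<open>k + 1\<close> trie nodes, one per level, so a trie over all
  \<open>m\<close> keys may exceed O(\<open>m\<close>) nodes; with one sample among
  \<open>k + 1\<close> keys there are fewer than \<open>m\<close>. Each bisection starts from an
  interval of length at most \<open>k + 2\<close>, and \<open>k \<le> lg n + 1\<close>, so either
  takes lglg n + O(1) rounds. The program may not depend on the graph, so \<open>k\<close>, the hash
  parameters and the table offsets are all read from memory. A query also looks up nodes that are
  absent from the trie; hence the bounds on hash values hold for all arguments, and only injectivity
  is restricted to the stored nodes. Charging to endpoints alone would not do, since an endpoint may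
  have many out-arcs or in-arcs, each giving rise to an exception. But an arc that is not the first
  of its path has an internal tail, and one that is not the last has an internal head, so these
  exceptions number at most one of each kind per path.\<close>

lemma card_multiples_mod_less:
  fixes N L z :: nat
  assumes "0 < z"
  shows "card {a. a < N \<and> a * z mod N < L} \<le> L + z"
proof -
  let ?S = "{a. a < N \<and> a * z mod N < L}"
  \<comment> \<open>The first component is below \<open>z\<close> and the second takes at most
    \<open>L div z + 1\<close> values, while together they fix \<open>a * z\<close> up to an error
    below \<open>z\<close> and hence fix \<open>a\<close>. This works whether or not
    \<open>z\<close> and \<open>N\<close> are coprime, which is why no prime modulus is
    involved.\<close>
  let ?f = "\<lambda>a. (a * z div N, (a * z mod N) div z)"
  have inj: "inj_on ?f ?S"
  proof (rule inj_onI)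
    fix a b assume ab: "?f a = ?f b"
    have *: "c * z = (c * z div N) * N + ((c * z mod N) div z) * z + (c * z mod N) mod z" for c
      by (metis add.assoc div_mult_mod_eq)
    have ab': "a * z div N = b * z div N" "(a * z mod N) div z = (b * z mod N) div z"
      using ab by simp_all
    have "a * z - b * z < z \<and> b * z - a * z < z"
    proof -
      have "a * z = (b * z div N) * N + ((b * z mod N) div z) * z + (a * z mod N) mod z"
        using *[of a] unfolding ab' .
      then show ?thesis
        using *[of b] mod_less_divisor[OF assms, of "a * z mod N"]
          mod_less_divisor[OF assms, of "b * z mod N"] by linarith
    qed
    then have "(a - b) * z < 1 * z" "(b - a) * z < 1 * z"
      by (simp_all add: diff_mult_distrib)
    then have "a - b < 1" "b - a < 1"
      unfolding mult_less_cancel2 by blast+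
    then show "a = b" by simp
  qed
  have "a * z div N < z" if "a < N" for a
    using that assms by (simp add: less_mult_imp_div_less mult.commute)
  moreover have "c < L \<Longrightarrow> c div z \<le> L div z" for c
    by (simp add: div_le_mono)
  ultimately have "?f ` ?S \<subseteq> {..<z} \<times> {..L div z}" by auto
  then have "card (?f ` ?S) \<le> card ({..<z} \<times> {..L div z})"
    by (intro card_mono) auto
  also have "\<dots> = z * (L div z) + z" by simp
  also have "\<dots> \<le> L + z" by simp
  finally show ?thesis using card_image[OF inj] by simp
qed

text \<open>The reflection of \<open>a\<close> to \<open>N - a\<close> turns a residue
  \<open>r > 0\<close> into \<open>N - r\<close>, which reduces the count to small residues;
  \<open>a = 0\<close> has residue 0 and is not counted.\<close>

lemma card_multiples_mod_greater:
  fixes N L z :: nat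
  assumes "0 < z" "L \<le> N"
  shows "card {a. a < N \<and> N < a * z mod N + L} \<le> L + z"
proof -
  let ?S = "{a. a < N \<and> N < a * z mod N + L}"
  have "(\<lambda>a. N - a) ` ?S \<subseteq> {a. a < N \<and> a * z mod N < L}"
  proof safe
    fix a assume a: "a < N" "N < a * z mod N + L"
    have "a \<noteq> 0" using a assms(2) by (cases "a = 0") auto
    then show "N - a < N" using a by simp
    have pos: "0 < a * z mod N" using a(2) assms(2) by (cases "a * z mod N = 0") auto
    have "(N - a) * z + a * z = z * N" using a(1) by (simp add: algebra_simps)
    then have "(N - a) * z = z * N - a * z" by simp
    also have "\<dots> = z * N - (a * z div N * N + a * z mod N)" by simp
    also have "\<dots> = (z - a * z div N - 1) * N + (N - a * z mod N)"
    proof -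
      have "a * z div N < z" using a(1) assms by (simp add: less_mult_imp_div_less mult.commute)
      then obtain d where "z = a * z div N + 1 + d" by (metis Suc_eq_plus1 less_iff_Suc_add add_Suc)
      then obtain q where q: "z = q + 1 + d" "q = a * z div N" by blast
      have "a * z mod N < N" using a(1) by simp
      then show ?thesis unfolding q(2)[symmetric] by (subst (1 2) q(1)) (simp add: algebra_simps)
    qed
    finally have "(N - a) * z mod N = (N - a * z mod N) mod N" by simp
    also have "\<dots> = N - a * z mod N" using pos a(1) by simp
    finally show "(N - a) * z mod N < L" using a(2) mod_less_divisor[of N "a * z"] a(1) by linarith
  qed
  moreover have "finite {a. a < N \<and> a * z mod N < L}" by simp
  ultimately have "card ((\<lambda>a. N - a) ` ?S) \<le> L + z"
    using card_mono card_multiples_mod_less[OF assms(1), of N L] by (meson le_trans)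
  moreover have "inj_on (\<lambda>a. N - a) ?S" by (rule inj_onI) auto
  ultimately show ?thesis by (simp add: card_image)
qed

text \<open>Multiply-shift hashing with the shift replaced by a division, so that table sizes need
  not be powers of two: \<open>L = N div s + 1\<close> gives values below \<open>s\<close>.\<close>

definition mult_hash :: "nat \<Rightarrow> nat \<Rightarrow> nat \<Rightarrow> nat \<Rightarrow> nat" where
  "mult_hash N L a x = (a * x mod N) div L"

text \<open>Residues with equal quotients by \<open>L\<close> differ by less than \<open>L\<close>,
  so modulo \<open>N\<close> the multiple of \<open>y - x\<close> is within \<open>L\<close> of 0,
  on one side or the other.\<close>

lemma mult_hash_collision:
  assumes "x < y" "mult_hash N L a x = mult_hash N L a y" "0 < N" "0 < L"
  shows "a * (y - x) mod N < L \<or> N < a * (y - x) mod N + L"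
proof -
  define X Y where "X = a * x mod N" and "Y = a * y mod N"
  have "X div L = Y div L" using assms(2) by (simp add: mult_hash_def X_def Y_def)
  then have close: "X < Y + L" "Y < X + L"
    using mod_less_divisor[OF assms(4), of X] mod_less_divisor[OF assms(4), of Y]
      div_mult_mod_eq[of X L] div_mult_mod_eq[of Y L] by (linarith | simp)+
  have XY: "X < N" "Y < N" using assms(3) by (simp_all add: X_def Y_def)
  have "int (a * (y - x)) mod int N = (int Y - int X) mod int N"
    using assms(1) unfolding X_def Y_def
    by (simp add: zmod_int mod_diff_eq of_nat_diff right_diff_distrib)
  then have eq: "int (a * (y - x) mod N) = (int Y - int X) mod int N"
    by (simp add: zmod_int)
  show ?thesis
  proof (cases "X \<le> Y")
    case True
    then have "(int Y - int X) mod int N = int Y - int X" using XY by simp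
    then show ?thesis using eq close by linarith
  next
    case False
    then have "(int Y - int X + int N) mod int N = int Y - int X + int N"
      using XY by (intro mod_pos_pos_trivial) auto
    then have "(int Y - int X) mod int N = int Y - int X + int N" by simp
    then show ?thesis using eq close by linarith
  qed
qed

text \<open>Each side contributes at most \<open>L + (y - x)\<close> multipliers, and the difference
  is below \<open>Z \<le> L\<close>. So a random multiplier makes two given keys collide with
  probability at most \<open>4 * L / N\<close>.\<close>

lemma card_mult_hash_collision:
  assumes "x < Z" "y < Z" "x \<noteq> y" "Z \<le> L" "L \<le> N"
  shows "card {a. a < N \<and> mult_hash N L a x = mult_hash N L a y} \<le> 4 * L"
proof -
  have *: "card {a. a < N \<and> mult_hash N L a x = mult_hash N L a y} \<le> 4 * L"
    if xy: "x < y" "y < Z" for x y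
  proof -
    let ?S = "{a. a < N \<and> a * (y - x) mod N < L}" and ?T = "{a. a < N \<and> N < a * (y - x) mod N + L}"
    have "{a. a < N \<and> mult_hash N L a x = mult_hash N L a y} \<subseteq> ?S \<union> ?T"
      using mult_hash_collision[OF xy(1), of N L] xy assms by auto
    then have "card {a. a < N \<and> mult_hash N L a x = mult_hash N L a y} \<le> card (?S \<union> ?T)"
      by (intro card_mono) auto
    also have "\<dots> \<le> card ?S + card ?T" by (rule card_Un_le)
    also have "\<dots> \<le> (L + (y - x)) + (L + (y - x))"
      using xy assms by (intro add_mono card_multiples_mod_less card_multiples_mod_greater) auto
    also have "\<dots> \<le> 4 * L" using xy assms by simp
    finally show ?thesis .
  qed
  show ?thesis
    using *[of x y] *[of y x] assms by (cases "x < y") (auto simp: eq_commute)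
qed

definition collisions :: "nat \<Rightarrow> nat \<Rightarrow> nat \<Rightarrow> nat set \<Rightarrow> (nat \<times> nat) set" where
  "collisions N L a A = {(x, y) \<in> A \<times> A. x \<noteq> y \<and> mult_hash N L a x = mult_hash N L a y}"

text \<open>Were all multipliers worse than this, the total over \<open>a < N\<close>, summed
  instead over ordered pairs of distinct keys, would exceed the pairwise bound.\<close>

lemma mult_hash_averaging:
  assumes "finite A" "A \<subseteq> {..<Z}" "Z \<le> L" "L \<le> N" "0 < N"
  shows "\<exists>a<N. card (collisions N L a A) * N \<le> card A * (card A - 1) * (4 * L)"
proof (rule ccontr)
  assume "\<not> ?thesis"
  then have gt: "card A * (card A - 1) * (4 * L) < card (collisions N L a A) * N" if "a < N" for a
    using that by (meson not_less)
  let ?O = "{(x, y) \<in> A \<times> A. x \<noteq> y}"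
  have "?O = A \<times> A - (\<lambda>x. (x, x)) ` A" by auto
  then have card_O: "card ?O = card A * (card A - 1)" and fin_O: "finite ?O"
    using assms(1) card_Diff_subset[of "(\<lambda>x. (x, x)) ` A" "A \<times> A"]
    by (auto simp: card_image inj_on_def card_cartesian_product diff_mult_distrib2 image_subset_iff)
  have "N * (card A * (card A - 1) * (4 * L)) = (\<Sum>a<N. card A * (card A - 1) * (4 * L))" by simp
  also have "\<dots> < (\<Sum>a<N. card (collisions N L a A) * N)"
    using assms gt by (intro sum_strict_mono) auto
  also have "\<dots> = (\<Sum>a<N. \<Sum>(x, y)\<in>?O. of_bool (mult_hash N L a x = mult_hash N L a y)) * N"
  proof -
    have "collisions N L a A = ?O \<inter> {(x, y). mult_hash N L a x = mult_hash N L a y}" for a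
      by (auto simp: collisions_def)
    then show ?thesis
      using fin_O by (simp add: sum_distrib_right case_prod_unfold of_bool_def sum.If_cases)
  qed
  also have "\<dots> = (\<Sum>(x, y)\<in>?O. \<Sum>a<N. of_bool (mult_hash N L a x = mult_hash N L a y)) * N"
    by (subst sum.swap) (simp add: case_prod_unfold)
  also have "\<dots> = (\<Sum>(x, y)\<in>?O. card {a. a < N \<and> mult_hash N L a x = mult_hash N L a y}) * N"
    by (simp add: of_bool_def sum.If_cases Int_def)
  also have "\<dots> \<le> (\<Sum>(x, y)\<in>?O. 4 * L) * N"
    using assms(2) by (intro mult_right_mono sum_mono)
      (auto intro!: card_mult_hash_collision[OF _ _ _ assms(3,4)])
  also have "\<dots> = card A * (card A - 1) * (4 * L) * N"
    using card_O by (simp add: case_prod_unfold)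
  finally show False by (simp add: mult.commute)
qed

text \<open>The divisor satisfies \<open>?L * s \<le> 2 * N\<close>, which turns the factor 4 of the
  pairwise bound into 8. The assumption \<open>Z * s \<le> N\<close> makes the divisor exceed all
  differences of keys.\<close>

lemma mult_hash_few_collisions:
  assumes "finite A" "A \<subseteq> {..<Z}" "2 \<le> s" "0 < Z" "Z * s \<le> N" "4 \<le> N"
  shows "\<exists>a<N. card (collisions N (N div s + 1) a A) * s \<le> 8 * (card A * (card A - 1))"
proof -
  let ?L = "N div s + 1"
  have "Z \<le> N div s" using assms by (simp add: less_eq_div_iff_mult_less_eq)
  moreover have "N div s \<le> N div 2" using assms by (simp add: div_le_mono2)
  moreover have "N div 2 + 1 \<le> N" using assms(6) by linarith
  ultimately obtain a where a: "a < N"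
      "card (collisions N ?L a A) * N \<le> card A * (card A - 1) * (4 * ?L)"
    using mult_hash_averaging[OF assms(1,2), of ?L N] assms(6) by auto
  have "s \<le> N" using assms(4,5) by (metis mult_le_cancel2 le_trans mult_1 Suc_leI One_nat_def)
  then have sL: "?L * s \<le> 2 * N"
    using div_times_less_eq_dividend[of N s] unfolding add_mult_distrib by linarith
  have "card (collisions N ?L a A) * s * N = card (collisions N ?L a A) * N * s" by simp
  also have "\<dots> \<le> card A * (card A - 1) * (4 * ?L) * s"
    using a(2) by (rule mult_right_mono) simp
  also have "\<dots> = card A * (card A - 1) * 4 * (?L * s)" by (simp only: mult_ac)
  also have "\<dots> \<le> card A * (card A - 1) * 4 * (2 * N)" using sL by (rule mult_left_mono) simp
  also have "\<dots> = 8 * (card A * (card A - 1)) * N" by simp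
  finally show ?thesis using a(1) assms(6) by auto
qed

lemma mult_hash_less:
  assumes "0 < s" "0 < N"
  shows "mult_hash N (N div s + 1) a x < s"
proof -
  have "a * x mod N < N" using assms by simp
  also have "N \<le> s * (N div s + 1)"
    using assms(1) dividend_less_times_div[of s N] by simp
  finally show ?thesis unfolding mult_hash_def by (simp add: less_mult_imp_div_less)
qed

text \<open>
  Two-level hashing with quadratic tables on the second level. Any modulus \<open>N\<close> that is large
  compared to the keys will do, so that \<open>N = 2 ^ w\<close> reduces for free.
\<close>

lemma perfect_hashing:
  fixes A :: "nat set"
  assumes fin: "finite A" and sub: "A \<subseteq> {..<Z}" and N: "Z * (8 * Z * Z + 2) \<le> N"
    and card: "card A + 1 \<le> Z"
  shows "\<exists>a L \<alpha> \<Lambda> off.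
    a < N \<and> 0 < L \<and> L < N \<and> (\<forall>i. \<alpha> i < N \<and> 0 < \<Lambda> i \<and> \<Lambda> i < N) \<and>
    (\<forall>x. mult_hash N L a x \<le> card A \<and> off (mult_hash N L a x) \<le> 74 * card A + 2) \<and>
    (\<forall>x. off (mult_hash N L a x) +
       mult_hash N (\<Lambda> (mult_hash N L a x)) (\<alpha> (mult_hash N L a x)) x < 74 * card A + 2) \<and>
    inj_on (\<lambda>x. off (mult_hash N L a x) +
       mult_hash N (\<Lambda> (mult_hash N L a x)) (\<alpha> (mult_hash N L a x)) x) A"
proof -
  let ?m = "card A"
  have Z: "1 \<le> Z" using card by simp
  have "1 * (8 * 1 * 1 + 2) \<le> Z * (8 * Z * Z + 2)" using Z by (intro mult_mono add_mono) auto
  then have N4: "4 \<le> N" using N by simp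
  have big: "Z * s \<le> N" if "s \<le> 8 * Z * Z + 2" for s
    using that N by (meson le_trans mult_le_mono2)
  have L_bound: "N div s + 1 < N" if "2 \<le> s" for s
  proof -
    have "N div s \<le> N div 2" using that by (simp add: div_le_mono2)
    then show ?thesis using N4 by linarith
  qed
  show ?thesis
  proof (cases "A = {}")
    case True
    let ?L = "N div 2 + 1"
    have "mult_hash N ?L 0 x = 0" for x by (simp add: mult_hash_def)
    then show ?thesis
      using True L_bound[of 2] N4
      by (intro exI[of _ 0] exI[of _ ?L] exI[of _ "\<lambda>_. 0"] exI[of _ "\<lambda>_. ?L"] exI[of _ "\<lambda>_. 0"]) auto
  next
    case False
    then have m: "1 \<le> ?m" using fin by (simp add: Suc_leI card_gt_0_iff)
    have m1: "?m + 1 \<le> 8 * Z * Z + 2"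
    proof -
      have "Z \<le> Z * Z" "8 * Z * Z = 8 * (Z * Z)" by simp_all
      then show ?thesis using card by linarith
    qed
    define L where "L = N div (?m + 1) + 1"
    obtain a where a: "a < N" "card (collisions N L a A) * (?m + 1) \<le> 8 * (?m * (?m - 1))"
      using mult_hash_few_collisions[OF fin sub, of "?m + 1" N] m Z big[OF m1] N4
      unfolding L_def by auto
    define h where "h = mult_hash N L a"
    have h: "h x \<le> ?m" for x
      using mult_hash_less[of "?m + 1" N a x] N4 by (simp add: h_def L_def)
    have "card (collisions N L a A) * (?m + 1) \<le> 8 * ?m * (?m + 1)"
      using a(2) by (rule order_trans) (simp add: algebra_simps)
    then have coll: "card (collisions N L a A) \<le> 8 * ?m"
      unfolding mult_le_cancel2 by simp
    define b where "b i = card {x \<in> A. h x = i}" for i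
    \<comment> \<open>A size above \<open>8 * (b i * b i)\<close> forces the integral collision
      count below 1. The summand 2 gives empty bins a table too and meets the requirement of at
      least two slots.\<close>
    define s where "s i = 8 * (b i * b i) + 2" for i
    have bm: "b i \<le> ?m" for i unfolding b_def using fin by (intro card_mono) auto
    have sZ: "s i \<le> 8 * Z * Z + 2" for i
    proof -
      have "b i * b i \<le> Z * Z" using bm[of i] card by (intro mult_mono) auto
      then show ?thesis by (simp add: s_def)
    qed
    have "\<exists>\<alpha><N. card (collisions N (N div s i + 1) \<alpha> {x \<in> A. h x = i}) * s i \<le> 8 * (b i * (b i - 1))" for i
      unfolding b_def using fin sub Z N4 big[OF sZ]
      by (intro mult_hash_few_collisions) (auto simp: s_def)
    then obtain \<alpha> where \<alpha>: "\<alpha> i < N"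
      "card (collisions N (N div s i + 1) (\<alpha> i) {x \<in> A. h x = i}) * s i \<le> 8 * (b i * (b i - 1))" for i
      by metis
    define \<Lambda> where "\<Lambda> i = N div s i + 1" for i
    have no_coll: "collisions N (\<Lambda> i) (\<alpha> i) {x \<in> A. h x = i} = {}" for i
    proof -
      have "8 * (b i * (b i - 1)) \<le> 8 * (b i * b i)" by simp
      then have "8 * (b i * (b i - 1)) < 1 * s i" by (rule le_less_trans) (simp add: s_def)
      then have "card (collisions N (\<Lambda> i) (\<alpha> i) {x \<in> A. h x = i}) * s i < 1 * s i"
        using \<alpha>(2)[of i] unfolding \<Lambda>_def by (rule le_less_trans[rotated])
      then have "card (collisions N (\<Lambda> i) (\<alpha> i) {x \<in> A. h x = i}) = 0"
        unfolding mult_less_cancel2 by simp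
      moreover have "finite (collisions N (\<Lambda> i) (\<alpha> i) {x \<in> A. h x = i})"
        by (rule finite_subset[of _ "A \<times> A"]) (use fin in \<open>auto simp: collisions_def\<close>)
      ultimately show ?thesis by simp
    qed
    define off where "off i = (\<Sum>j<i. s j)" for i
    define pos where "pos x = off (h x) + mult_hash N (\<Lambda> (h x)) (\<alpha> (h x)) x" for x
    have second: "mult_hash N (\<Lambda> i) (\<alpha> i) x < s i" for i x
      unfolding \<Lambda>_def using N4 by (intro mult_hash_less) (auto simp: s_def)
    have pos_bounds: "off (h x) \<le> pos x" "pos x < off (Suc (h x))" for x
      using second[of "h x" x] by (simp_all add: pos_def off_def)
    have off_mono: "i \<le> j \<Longrightarrow> off i \<le> off j" for i j
      unfolding off_def by (intro sum_mono2) auto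
    have total: "off (Suc ?m) \<le> 74 * ?m + 2"
    proof -
      have part: "(\<Sum>i\<le>?m. card {x \<in> X. g x = i}) = card X"
        if "finite X" "\<And>x. g x \<le> ?m" for X :: "'a set" and g
      proof -
        have "card (\<Union>i\<le>?m. {x \<in> X. g x = i}) = (\<Sum>i\<le>?m. card {x \<in> X. g x = i})"
          using that by (intro card_UN_disjoint) auto
        moreover have "(\<Union>i\<le>?m. {x \<in> X. g x = i}) = X" using that by auto
        ultimately show ?thesis by simp
      qed
      \<comment> \<open>Ordered pairs in a common bin, diagonal included; their number is the sum of
        the squared bin sizes, at most \<open>8 * ?m + ?m\<close>. With \<open>?m + 1\<close> bins
        the tables need \<open>8 * 9 * ?m + 2 * (?m + 1)\<close> slots, whence 74.\<close>
      define X where "X = {(x, y) \<in> A \<times> A. h x = h y}"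
      have X: "X = collisions N L a A \<union> (\<lambda>x. (x, x)) ` A"
        by (auto simp: X_def collisions_def h_def)
      have finX: "finite X" by (rule finite_subset[of _ "A \<times> A"]) (use fin in \<open>auto simp: X_def\<close>)
      have "{p \<in> X. h (fst p) = i} = {x \<in> A. h x = i} \<times> {x \<in> A. h x = i}" for i
        by (auto simp: X_def)
      then have "(\<Sum>i\<le>?m. b i * b i) = (\<Sum>i\<le>?m. card {p \<in> X. h (fst p) = i})"
        by (simp add: b_def card_cartesian_product)
      also have "\<dots> = card X" using part[OF finX, of "h \<circ> fst"] h by simp
      also have "\<dots> \<le> card (collisions N L a A) + card ((\<lambda>x. (x, x)) ` A)"
        unfolding X by (rule card_Un_le)
      also have "\<dots> \<le> 8 * ?m + ?m" using coll card_image_le[OF fin, of "\<lambda>x. (x, x)"] by linarith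
      finally have "(\<Sum>i\<le>?m. b i * b i) \<le> 9 * ?m" by simp
      moreover have "off (Suc ?m) = 8 * (\<Sum>i\<le>?m. b i * b i) + 2 * (?m + 1)"
        unfolding off_def s_def lessThan_Suc_atMost sum.distrib sum_distrib_left by simp
      ultimately show ?thesis by simp
    qed
    have inj: "inj_on pos A"
    proof (rule inj_onI)
      fix x y assume xy: "x \<in> A" "y \<in> A" "pos x = pos y"
      have "h x = h y"
      proof (rule linorder_cases[of "h x" "h y"])
        assume "h x < h y"
        then show ?thesis using off_mono[of "Suc (h x)" "h y"] pos_bounds(2)[of x] pos_bounds(1)[of y] xy(3) by simp
      next
        assume "h y < h x"
        then show ?thesis using off_mono[of "Suc (h y)" "h x"] pos_bounds(2)[of y] pos_bounds(1)[of x] xy(3) by simp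
      qed
      then have "(x, y) \<in> collisions N (\<Lambda> (h x)) (\<alpha> (h x)) {z \<in> A. h z = h x} \<or> x = y"
        using xy by (auto simp: collisions_def pos_def)
      then show "x = y" using no_coll by auto
    qed
    have bound: "pos x < 74 * ?m + 2" "off (h x) \<le> 74 * ?m + 2" for x
      using pos_bounds[of x] off_mono[of "Suc (h x)" "Suc ?m"] h[of x] total by linarith+
    have LN: "0 < L" "L < N" using L_bound[of "?m + 1"] m by (simp_all add: L_def)
    have \<Lambda>N: "0 < \<Lambda> i" "\<Lambda> i < N" for i
      using L_bound[of "s i"] by (simp_all add: \<Lambda>_def s_def)
    show ?thesis
      using a(1) LN \<alpha>(1) \<Lambda>N h bound inj unfolding pos_def h_def
      by (intro exI[of _ a] exI[of _ L] exI[of _ \<alpha>] exI[of _ \<Lambda>] exI[of _ off]) auto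
  qed
qed

section \<open>Sampled tries\<close>

text \<open>With 0 among the keys every query has a predecessor, and \<open>sample 0\<close> is the
  default that stays out of the trie.\<close>

locale sampled_trie =
  fixes k m :: nat and s :: "nat \<Rightarrow> nat"
  assumes m_pos: "0 < m" and s_0: "s 0 = 0"
    and s_less: "i < j \<Longrightarrow> j < m \<Longrightarrow> s i < s j"
    and s_bound: "i < m \<Longrightarrow> s i < 2 ^ k"
begin

definition num_samples :: nat where
  "num_samples = (m - 1) div (k + 1)"

definition sample :: "nat \<Rightarrow> nat" where
  "sample q = s (q * (k + 1))"

text \<open>
  The nodes of the binary trie over \<open>k\<close>-bit keys are numbered as in a heap: 1 is the root and
  halving leads to the parent. The number 0 stands for a virtual parent of the root.
\<close>

definition node :: "nat \<Rightarrow> nat \<Rightarrow> nat" where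
  "node j x = (2 ^ k + x) div 2 ^ j"

definition nodes :: "nat set" where
  "nodes = (\<lambda>(q, j). node j (sample q)) ` ({1..num_samples} \<times> {..k})"

text \<open>The cardinalities of this set and of \<open>upto_node v\<close> are the two numbers
  stored with \<open>v\<close>: the number of samples before the least key under \<open>v\<close>,
  and the number up to the greatest. Height \<open>k + 1\<close> covers the virtual parent, which
  lies above all keys.\<close>

definition below :: "nat \<Rightarrow> nat set" where
  "below v = {q \<in> {1..num_samples}. \<forall>y<2 ^ k. \<forall>j\<le>k + 1. v = node j y \<longrightarrow> sample q < y}"

definition upto_node :: "nat \<Rightarrow> nat set" where
  "upto_node v = {q \<in> {1..num_samples}. \<exists>y<2 ^ k. \<exists>j\<le>k + 1. v = node j y \<and> sample q \<le> y}"

definition rank :: "nat \<Rightarrow> nat" where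
  "rank x = card {q \<in> {1..num_samples}. sample q \<le> x}"

lemma num_samples_le: "num_samples * (k + 1) \<le> m - 1"
  unfolding num_samples_def by (rule div_times_less_eq_dividend)

lemma sample_index: "q \<le> num_samples \<Longrightarrow> q * (k + 1) < m"
  using num_samples_le m_pos mult_le_mono1[of q num_samples "k + 1"] by linarith

lemma sample_less: "q < q' \<Longrightarrow> q' \<le> num_samples \<Longrightarrow> sample q < sample q'"
  unfolding sample_def by (intro s_less sample_index mult_strict_right_mono) auto

lemma sample_bound: "q \<le> num_samples \<Longrightarrow> sample q < 2 ^ k"
  unfolding sample_def by (intro s_bound sample_index)

lemma node_mono: "x \<le> y \<Longrightarrow> node j x \<le> node j y"
  by (simp add: node_def div_le_mono)

text \<open>Numbers at height \<open>j \<le> k\<close> lie in the interval from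
  \<open>2 ^ (k - j)\<close> to below \<open>2 ^ (k - j + 1)\<close>, and only height
  \<open>k + 1\<close> yields 0, so the number reveals the height.\<close>

lemma node_inj_level:
  assumes "node j x = node i y" "x < 2 ^ k" "y < 2 ^ k" "j \<le> k + 1" "i \<le> k + 1"
  shows "j = i"
proof -
  have *: "\<not> j < i" if "node j x = node i y" "y < 2 ^ k" "i \<le> k + 1" for i j x y
  proof
    assume "j < i"
    then have "j \<le> k" using that by simp
    have "2 ^ (k - j) * 2 ^ j \<le> (2 ^ k + x :: nat)"
      using \<open>j \<le> k\<close> by (simp flip: power_add)
    then have lower: "2 ^ (k - j) \<le> node j x"
      by (simp add: node_def less_eq_div_iff_mult_less_eq)
    have "(2::nat) ^ (k + 1) = 2 ^ (k + 1 - i) * 2 ^ i"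
      using that(3) by (simp only: power_add[symmetric] le_add_diff_inverse2)
    then have "2 ^ k + y < 2 ^ (k + 1 - i) * 2 ^ i" using that(2) by simp
    then have "node i y < 2 ^ (k + 1 - i)"
      by (simp add: node_def less_mult_imp_div_less)
    also have "\<dots> \<le> 2 ^ (k - j)" using \<open>j < i\<close> by (intro power_increasing) auto
    finally show False using lower that(1) by simp
  qed
  show ?thesis using *[of j x i y] *[of i y j x] assms by (metis linorder_neqE_nat)
qed

lemma node_Suc: "node (Suc j) x = node j x div 2"
  by (simp add: node_def power_Suc2 div_mult2_eq del: power_Suc)

lemma node_less: "x < 2 ^ k \<Longrightarrow> node j x < 2 ^ (k + 1)"
  unfolding node_def by (rule le_less_trans[OF div_le_dividend]) simp

lemma node_pos: "j \<le> k \<Longrightarrow> 0 < node j x"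
  unfolding node_def by (simp add: div_greater_zero_iff add_increasing2 power_increasing trans_le_add1)

lemma nodes_props: "finite nodes" "nodes \<subseteq> {..<2 ^ (k + 1)}" "card nodes < m" "0 \<notin> nodes"
proof -
  show "finite nodes" by (simp add: nodes_def)
  show "nodes \<subseteq> {..<2 ^ (k + 1)}"
    using sample_bound node_less unfolding nodes_def by auto
  show "0 \<notin> nodes"
  proof
    assume "0 \<in> nodes"
    then obtain q j where "j \<le> k" "0 = node j (sample q)" by (auto simp: nodes_def)
    then show False using node_pos[of j "sample q"] by simp
  qed
  have "card nodes \<le> card ({1..num_samples} \<times> {..k})"
    unfolding nodes_def by (rule card_image_le) simp
  also have "\<dots> = num_samples * (k + 1)" by simp
  finally show "card nodes < m" using num_samples_le m_pos by linarith
qed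

text \<open>Lets a set of sample indices be stored as its size, which is also the largest index in
  it.\<close>

lemma downward_closed_card:
  assumes "A \<subseteq> {1..n}" "\<And>p q :: nat. q \<in> A \<Longrightarrow> 1 \<le> p \<Longrightarrow> p < q \<Longrightarrow> p \<in> A"
  shows "A = {1..card A}"
proof (cases "A = {}")
  case False
  have fin: "finite A" using assms(1) finite_subset by blast
  have "A = {1..Max A}"
  proof
    show "A \<subseteq> {1..Max A}" using assms(1) fin by auto
    have "Max A \<in> A" using fin False by simp
    then show "{1..Max A} \<subseteq> A" using assms(2) by (metis atLeastAtMost_iff le_neq_implies_less subsetI)
  qed
  then show ?thesis by (metis card_atLeastAtMost diff_Suc_1)
qed auto

lemma rank_set: "{q \<in> {1..num_samples}. sample q \<le> x} = {1..rank x}"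
  unfolding rank_def
proof (rule downward_closed_card)
  fix p q assume "q \<in> {q \<in> {1..num_samples}. sample q \<le> x}" "1 \<le> p" "p < q"
  then show "p \<in> {q \<in> {1..num_samples}. sample q \<le> x}"
    using sample_less[of p q] by auto
qed blast

lemma rank_props:
  "rank x \<le> num_samples" "s (rank x * (k + 1)) \<le> x"
  "rank x < num_samples \<Longrightarrow> x < s ((rank x + 1) * (k + 1))"
proof -
  have eq: "1 \<le> q \<and> q \<le> num_samples \<and> sample q \<le> x \<longleftrightarrow> 1 \<le> q \<and> q \<le> rank x" for q
    using rank_set[of x] by (auto simp: set_eq_iff)
  show "rank x \<le> num_samples" using eq[of "rank x"] by (cases "rank x = 0") auto
  show "s (rank x * (k + 1)) \<le> x"
    using eq[of "rank x"] s_0 by (cases "rank x = 0") (auto simp: sample_def)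
  show "x < s ((rank x + 1) * (k + 1))" if "rank x < num_samples"
    using eq[of "rank x + 1"] that by (auto simp: sample_def)
qed

lemma upto_node_set: "upto_node v = {1..card (upto_node v)}"
proof (rule downward_closed_card)
  show "upto_node v \<subseteq> {1..num_samples}" by (auto simp: upto_node_def)
  fix p q assume "q \<in> upto_node v" "1 \<le> p" "p < q"
  then show "p \<in> upto_node v"
    using sample_less[of p q] unfolding upto_node_def by (auto intro: less_imp_le less_le_trans)
qed

lemma card_node_sets: "card (upto_node v) \<le> num_samples" "card (below v) \<le> num_samples"
proof -
  have "upto_node v \<subseteq> {1..num_samples}" "below v \<subseteq> {1..num_samples}"
    by (auto simp: upto_node_def below_def)
  from this[THEN card_mono[rotated]] show "card (upto_node v) \<le> num_samples" "card (below v) \<le> num_samples"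
    by simp_all
qed

text \<open>
  At the deepest node \<open>v\<close> on the path to \<open>x\<close> that belongs to the trie, the child towards \<open>x\<close> is
  missing. So the samples below \<open>v\<close> are either all smaller or all greater than \<open>x\<close>, and one
  comparison decides between the two.
\<close>

lemma rank_at_deepest_node:
  assumes x: "x < 2 ^ k" and j: "j \<le> k + 1"
    and deepest: "j = 0 \<or> node (j - 1) x \<notin> nodes"
  shows "rank x = (if x < sample (card (upto_node (node j x)))
    then card (below (node j x)) else card (upto_node (node j x)))"
proof -
  define v where "v = node j x"
  define h where "h = card (upto_node v)"
  have up: "upto_node v = {1..h}" unfolding h_def by (rule upto_node_set)
  let ?A = "{q \<in> {1..num_samples}. sample q \<le> x}"
  have lo: "below v \<subseteq> ?A"
    using x j unfolding below_def v_def by (auto intro: less_imp_le)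
  have hi: "?A \<subseteq> upto_node v"
    using x j unfolding upto_node_def v_def by auto
  show ?thesis
  proof (cases "x < sample h")
    case False
    then have "upto_node v \<subseteq> ?A"
    proof -
      have "sample q \<le> sample h" if "q \<in> {1..h}" for q
        using sample_less[of q h] that card_node_sets(1)[of v]
        by (cases "q = h") (auto simp: h_def)
      then have "sample q \<le> x" if "q \<in> upto_node v" for q
        using that False up by (metis le_trans not_less)
      then show ?thesis by (auto simp: upto_node_def)
    qed
    with hi have "?A = upto_node v" by blast
    then show ?thesis using False by (simp add: rank_def h_def v_def)
  next
    case True
    have "sample 0 = 0" by (simp add: sample_def s_0)
    then have "h \<noteq> 0" using True by (metis not_less0)
    then have "h \<in> upto_node v" using up by simp
    then obtain y i where y: "y < 2 ^ k" "i \<le> k + 1" "v = node i y" "sample h \<le> y"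
      and h: "1 \<le> h" "h \<le> num_samples"
      by (auto simp: upto_node_def)
    have "i = j" using node_inj_level[of i y j x] y x j by (simp add: v_def)
    \<comment> \<open>\<open>x\<close> and \<open>y\<close> lie under the same node and
      \<open>sample h\<close> lies between them, hence under it as well.\<close>
    then have node_h: "node j (sample h) = v"
      using node_mono[of x "sample h" j] node_mono[of "sample h" y j] y True by (simp add: v_def)
    have "?A \<subseteq> below v"
    proof (rule subsetI, rule ccontr)
      fix q assume q: "q \<in> ?A" "q \<notin> below v"
      then obtain y i where y: "y < 2 ^ k" "i \<le> k + 1" "v = node i y" "y \<le> sample q"
        by (auto simp: below_def not_less)
      have "i = j" using node_inj_level[of i y j x] y x j by (simp add: v_def)
      then have node_q: "node j (sample q) = v"
        using node_mono[of y "sample q" j] node_mono[of "sample q" x j] y q by (simp add: v_def)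
      show False
      proof (cases j)
        case 0
        then show False using node_h True by (simp add: node_def v_def)
      next
        case (Suc i)
        have "node i (sample q) div 2 = node i x div 2" "node i (sample h) div 2 = node i x div 2"
          using node_q node_h unfolding Suc v_def node_Suc by simp_all
        moreover have "node i (sample q) \<le> node i x" "node i x \<le> node i (sample h)"
          using q True by (auto intro!: node_mono)
        \<comment> \<open>The child towards \<open>x\<close> lies between the children towards
          \<open>sample q\<close> and \<open>sample h\<close>. As \<open>v\<close> has only two
          children, it coincides with one of these and would belong to the trie.\<close>
        ultimately have "node i x = node i (sample q) \<or> node i x = node i (sample h)" by linarith
        moreover have "node i (sample p) \<in> nodes" if "1 \<le> p" "p \<le> num_samples" for p
          unfolding nodes_def using that Suc j by (intro image_eqI[of _ _ "(p, i)"]) auto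
        ultimately have "node i x \<in> nodes" using q h by auto
        then show False using deepest Suc by simp
      qed
    qed
    with lo have "?A = below v" by blast
    then show ?thesis using True by (simp add: rank_def h_def v_def)
  qed
qed

text \<open>The next sample exceeds \<open>x\<close> by the choice of the rank; after the last
  sample fewer than \<open>k + 1\<close> keys follow, so its bucket ends at
  \<open>m\<close>.\<close>

lemma bucket:
  fixes x defines "i \<equiv> rank x * (k + 1)"
  shows "i < m" "s i \<le> x" "min (i + (k + 1)) m = m \<or> x < s (min (i + (k + 1)) m)"
proof -
  show "i < m" unfolding i_def by (rule sample_index) (rule rank_props)
  show "s i \<le> x" unfolding i_def by (rule rank_props)
  show "min (i + (k + 1)) m = m \<or> x < s (min (i + (k + 1)) m)"
  proof (cases "rank x < num_samples")
    case True
    then have "i + (k + 1) < m" using sample_index[of "rank x + 1"] by (simp add: i_def)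
    then have "min (i + (k + 1)) m = (rank x + 1) * (k + 1)" by (simp add: i_def)
    then show ?thesis using rank_props(3)[OF True] by metis
  next
    case False
    then have "rank x = num_samples" using rank_props(1)[of x] by simp
    moreover have "m - 1 < num_samples * (k + 1) + (k + 1)"
      unfolding num_samples_def using dividend_less_div_times[of "k + 1" "m - 1"] by simp
    ultimately have "m \<le> i + (k + 1)" by (simp add: i_def)
    then show ?thesis by simp
  qed
qed

end

section \<open>The query program\<close>

text \<open>
  Registers: 0 the query \<open>x\<close>; 2, 3, 16 the constants 1, 16, 0; 4 and 5 the multiplier and the
  divisor of the first-level hash function; 6 holds \<open>k + 1\<close> and 17 holds \<open>2 ^ k + x\<close>; 7 the address
  preceding the two candidates of the deepest node found so far; 8 and 9 the bounds of the current
  bisection; the others are temporary. Register 16 is never written.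

  The memory consists of records of 16 cells. Cells 0 to 2 of record \<open>i\<close> describe the \<open>i\<close>-th bin of the
  first-level hash table (multiplier, divisor, offset), cells 3 to 5 the \<open>i\<close>-th slot of the second-level
  tables (key, and the two candidates for the start of the bucket), cells 6 to 8 the \<open>i\<close>-th
  sorted key, its value, and the end of a bucket starting there. Cells 9 to 14 of record 0 hold
  the global constants, the last two of them being the candidates for the virtual parent of the root.
\<close>

definition phi_program :: "instr list" where
  "phi_program =
    [ IConst 2 1, IConst 3 16, IConst 10 9, ILoad 4 10, IBin OpAdd 10 10 2, ILoad 5 10,
      IBin OpAdd 10 10 2, ILoad 6 10, IBin OpAdd 7 10 2, ILoad 17 7, IBin OpAdd 17 17 0,
      IConst 8 0, IBin OpAdd 9 6 2,
      \<comment> \<open>13: bisection over the depths\<close>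
      IBin OpSub 10 9 8, IJumpLess 2 10 16, IJump 41,
      IBin OpAdd 10 8 9, IBin OpShr 10 10 2, IBin OpSub 11 6 10, IBin OpShr 11 17 11,
      IBin OpMul 12 4 11, IBin OpDiv 12 12 5, IBin OpMul 12 12 3, ILoad 13 12,
      IBin OpAdd 12 12 2, ILoad 14 12, IBin OpAdd 12 12 2, ILoad 15 12,
      IBin OpMul 13 13 11, IBin OpDiv 13 13 14, IBin OpAdd 13 13 15, IBin OpMul 13 13 3,
      IConst 14 3, IBin OpAdd 13 13 14, ILoad 14 13, IJumpEq 14 11 38,
      IBin OpAdd 9 10 16, IJump 13,
      IBin OpAdd 8 10 16, IBin OpAdd 7 13 16, IJump 13,
      \<comment> \<open>41: selection of the bucket\<close>
      IBin OpAdd 7 7 2, ILoad 8 7, IBin OpAdd 7 7 2, ILoad 9 7, IConst 15 6,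
      IBin OpMul 10 9 3, IBin OpAdd 10 10 15, ILoad 10 10, IJumpLess 0 10 51,
      IBin OpAdd 8 9 16,
      IBin OpMul 10 8 3, IConst 14 8, IBin OpAdd 10 10 14, ILoad 9 10,
      \<comment> \<open>55: bisection in the bucket\<close>
      IBin OpSub 10 9 8, IJumpLess 2 10 58, IJump 68,
      IBin OpAdd 10 8 9, IBin OpShr 10 10 2, IBin OpMul 11 10 3, IBin OpAdd 11 11 15,
      ILoad 11 11, IJumpLess 0 11 66,
      IBin OpAdd 8 10 16, IJump 55,
      IBin OpAdd 9 10 16, IJump 55,
      \<comment> \<open>68: result\<close>
      IBin OpMul 10 8 3, IBin OpAdd 10 10 15, ILoad 11 10, IBin OpAdd 10 10 2, ILoad 12 10,
      IBin OpSub 0 0 11, IBin OpAdd 0 12 0 ]"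

lemma length_phi_program [simp]: "length phi_program = 75"
  by (simp add: phi_program_def)

lemma phi_program_nth:
  "phi_program ! 0 = IConst 2 1"
  "phi_program ! 1 = IConst 3 16"
  "phi_program ! 2 = IConst 10 9"
  "phi_program ! 3 = ILoad 4 10"
  "phi_program ! 4 = IBin OpAdd 10 10 2"
  "phi_program ! 5 = ILoad 5 10"
  "phi_program ! 6 = IBin OpAdd 10 10 2"
  "phi_program ! 7 = ILoad 6 10"
  "phi_program ! 8 = IBin OpAdd 7 10 2"
  "phi_program ! 9 = ILoad 17 7"
  "phi_program ! 10 = IBin OpAdd 17 17 0"
  "phi_program ! 11 = IConst 8 0"
  "phi_program ! 12 = IBin OpAdd 9 6 2"
  "phi_program ! 13 = IBin OpSub 10 9 8"
  "phi_program ! 14 = IJumpLess 2 10 16"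
  "phi_program ! 15 = IJump 41"
  "phi_program ! 16 = IBin OpAdd 10 8 9"
  "phi_program ! 17 = IBin OpShr 10 10 2"
  "phi_program ! 18 = IBin OpSub 11 6 10"
  "phi_program ! 19 = IBin OpShr 11 17 11"
  "phi_program ! 20 = IBin OpMul 12 4 11"
  "phi_program ! 21 = IBin OpDiv 12 12 5"
  "phi_program ! 22 = IBin OpMul 12 12 3"
  "phi_program ! 23 = ILoad 13 12"
  "phi_program ! 24 = IBin OpAdd 12 12 2"
  "phi_program ! 25 = ILoad 14 12"
  "phi_program ! 26 = IBin OpAdd 12 12 2"
  "phi_program ! 27 = ILoad 15 12"
  "phi_program ! 28 = IBin OpMul 13 13 11"
  "phi_program ! 29 = IBin OpDiv 13 13 14"
  "phi_program ! 30 = IBin OpAdd 13 13 15"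
  "phi_program ! 31 = IBin OpMul 13 13 3"
  "phi_program ! 32 = IConst 14 3"
  "phi_program ! 33 = IBin OpAdd 13 13 14"
  "phi_program ! 34 = ILoad 14 13"
  "phi_program ! 35 = IJumpEq 14 11 38"
  "phi_program ! 36 = IBin OpAdd 9 10 16"
  "phi_program ! 37 = IJump 13"
  "phi_program ! 38 = IBin OpAdd 8 10 16"
  "phi_program ! 39 = IBin OpAdd 7 13 16"
  "phi_program ! 40 = IJump 13"
  "phi_program ! 41 = IBin OpAdd 7 7 2"
  "phi_program ! 42 = ILoad 8 7"
  "phi_program ! 43 = IBin OpAdd 7 7 2"
  "phi_program ! 44 = ILoad 9 7"
  "phi_program ! 45 = IConst 15 6"
  "phi_program ! 46 = IBin OpMul 10 9 3"
  "phi_program ! 47 = IBin OpAdd 10 10 15"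
  "phi_program ! 48 = ILoad 10 10"
  "phi_program ! 49 = IJumpLess 0 10 51"
  "phi_program ! 50 = IBin OpAdd 8 9 16"
  "phi_program ! 51 = IBin OpMul 10 8 3"
  "phi_program ! 52 = IConst 14 8"
  "phi_program ! 53 = IBin OpAdd 10 10 14"
  "phi_program ! 54 = ILoad 9 10"
  "phi_program ! 55 = IBin OpSub 10 9 8"
  "phi_program ! 56 = IJumpLess 2 10 58"
  "phi_program ! 57 = IJump 68"
  "phi_program ! 58 = IBin OpAdd 10 8 9"
  "phi_program ! 59 = IBin OpShr 10 10 2"
  "phi_program ! 60 = IBin OpMul 11 10 3"
  "phi_program ! 61 = IBin OpAdd 11 11 15"
  "phi_program ! 62 = ILoad 11 11"
  "phi_program ! 63 = IJumpLess 0 11 66"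
  "phi_program ! 64 = IBin OpAdd 8 10 16"
  "phi_program ! 65 = IJump 55"
  "phi_program ! 66 = IBin OpAdd 9 10 16"
  "phi_program ! 67 = IJump 55"
  "phi_program ! 68 = IBin OpMul 10 8 3"
  "phi_program ! 69 = IBin OpAdd 10 10 15"
  "phi_program ! 70 = ILoad 11 10"
  "phi_program ! 71 = IBin OpAdd 10 10 2"
  "phi_program ! 72 = ILoad 12 10"
  "phi_program ! 73 = IBin OpSub 0 0 11"
  "phi_program ! 74 = IBin OpAdd 0 12 0"
  by (simp_all add: phi_program_def)

section \<open>Symbolic execution of straight-line fragments\<close>

lemma run_steps_numeral:
  "run_steps w P (numeral n) c = Option.bind (step w P c) (run_steps w P (pred_numeral n))"
  by (simp add: numeral_eq_Suc)

lemma run_steps_add: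
  "run_steps w P (t + t') c = Option.bind (run_steps w P t c) (run_steps w P t')"
proof (induction t arbitrary: c)
  case (Suc t)
  then show ?case by (cases "step w P c") simp_all
qed simp

lemma run_steps_1: "run_steps w P 1 c = step w P c"
  by (cases "step w P c") simp_all

lemma sub_mod_word: "y \<le> x \<Longrightarrow> x < N \<Longrightarrow> (x + N - y) mod N = x - y" for x y N :: nat
  using mod_add_self2[of "x - y" N] by simp

lemma add_1_1: "x + 1 + 1 = x + (2::nat)"
  by simp

text \<open>Uses of these rules delete \<open>One_nat_def\<close> and \<open>add_2_eq_Suc'\<close>,
  so that addresses stay numerals and match the cells named in the assumptions.\<close>

lemmas exec_simps = run_steps_numeral run_steps_1 add_1_1 step_def phi_program_nth sub_mod_word

lemma exec_init:
  assumes "0 < w" "16 < (2::nat) ^ w" "16 \<le> length M" "M ! 12 + x < 2 ^ w" "M ! 11 + 1 < 2 ^ w"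
  shows "\<exists>R. run_steps w phi_program 13 (0, (\<lambda>_. 0)(0 := x), M) = Some (13, R, M) \<and>
    R 0 = x \<and> R 2 = 1 \<and> R 3 = 16 \<and> R 16 = 0 \<and> R 4 = M ! 9 \<and> R 5 = M ! 10 \<and> R 6 = M ! 11 \<and>
    R 7 = 12 \<and> R 17 = M ! 12 + x \<and> R 8 = 0 \<and> R 9 = M ! 11 + 1"
  using assms by (simp add: exec_simps del: One_nat_def add_2_eq_Suc')

lemma exec_loop_exit:
  assumes "R 2 = 1" "R 8 \<le> R 9" "R 9 < 2 ^ w" "\<not> 1 < R 9 - R 8"
  shows "run_steps w phi_program 3 (13, R, M) = Some (41, R(10 := R 9 - R 8), M)"
    "run_steps w phi_program 3 (55, R, M) = Some (68, R(10 := R 9 - R 8), M)"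
  using assms by (simp_all add: exec_simps del: One_nat_def add_2_eq_Suc')

lemma exec_loop_enter:
  assumes "R 2 = 1" "R 8 \<le> R 9" "R 8 + R 9 < 2 ^ w" "1 < R 9 - R 8"
  shows "run_steps w phi_program 4 (13, R, M) =
      Some (18, R(10 := (R 8 + R 9) div 2), M)"
    "run_steps w phi_program 4 (55, R, M) = Some (60, R(10 := (R 8 + R 9) div 2), M)"
  using assms by (simp_all add: exec_simps del: One_nat_def add_2_eq_Suc')

text \<open>Wraparound is wanted in the two products with \<open>v\<close>, where it is the
  reduction by the hash modulus; elsewhere the size assumptions exclude it.\<close>

lemma exec_lookup:
  assumes regs: "R 2 = 1" "R 3 = 16" "R 16 = 0"
    and w: "0 < w" "16 < (2::nat) ^ w" "length M < 2 ^ w"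
    and mid: "R 10 \<le> R 6" "R 6 < 2 ^ w"
    and v: "v = R 17 div 2 ^ (R 6 - R 10)"
    and h: "h = (R 4 * v mod 2 ^ w) div R 5" "h * 16 + 16 \<le> length M"
    and p: "p = (M ! (h * 16) * v mod 2 ^ w) div (M ! (h * 16 + 1)) + M ! (h * 16 + 2)"
      "p * 16 + 16 \<le> length M"
  shows "\<exists>t\<le>21. \<exists>R'. run_steps w phi_program t (18, R, M) = Some (13, R', M) \<and>
    (\<forall>i\<in>{0, 2, 3, 4, 5, 6, 16, 17}. R' i = R i) \<and>
    (if M ! (p * 16 + 3) = v then R' 7 = p * 16 + 3 \<and> R' 8 = R 10 \<and> R' 9 = R 9
     else R' 7 = R 7 \<and> R' 8 = R 8 \<and> R' 9 = R 10)"
proof -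
  have "run_steps w phi_program 10 (18, R, M) =
      Some (28, R(11 := v, 13 := M ! (h * 16), 14 := M ! (h * 16 + 1), 12 := h * 16 + 2, 15 := M ! (h * 16 + 2)), M)"
    using assms(1-9) h by (simp add: exec_simps del: One_nat_def add_2_eq_Suc')
  moreover
  have "run_steps w phi_program 7 (28, R(11 := v, 13 := M ! (h * 16),
      14 := M ! (h * 16 + 1), 12 := h * 16 + 2, 15 := M ! (h * 16 + 2)), M) =
      Some (35, R(11 := v, 12 := h * 16 + 2, 15 := M ! (h * 16 + 2), 13 := p * 16 + 3, 14 := M ! (p * 16 + 3)), M)"
    using regs w p by (simp add: exec_simps del: One_nat_def add_2_eq_Suc')
  ultimately have run: "run_steps w phi_program (10 + 7) (18, R, M) =
      Some (35, R(11 := v, 12 := h * 16 + 2, 15 := M ! (h * 16 + 2), 13 := p * 16 + 3, 14 := M ! (p * 16 + 3)), M)"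
    unfolding run_steps_add by simp
  have p_word: "p * 16 + 3 < 2 ^ w" "R 10 < 2 ^ w" using p(2) w mid by linarith+
  show ?thesis
  proof (cases "M ! (p * 16 + 3) = v")
    case True
    have "\<exists>R'. run_steps w phi_program (10 + 7 + 4) (18, R, M) = Some (13, R', M) \<and>
        (\<forall>i\<in>{0, 2, 3, 4, 5, 6, 16, 17}. R' i = R i) \<and> R' 7 = p * 16 + 3 \<and> R' 8 = R 10 \<and> R' 9 = R 9"
      unfolding run_steps_add[of _ _ "10 + 7" 4] run
      using True regs p_word by (simp add: exec_simps del: One_nat_def add_2_eq_Suc')
    then show ?thesis using True by (intro exI[of _ "10 + 7 + 4"]) simp
  next
    case False
    have "\<exists>R'. run_steps w phi_program (10 + 7 + 3) (18, R, M) = Some (13, R', M) \<and>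
        (\<forall>i\<in>{0, 2, 3, 4, 5, 6, 16, 17}. R' i = R i) \<and> R' 7 = R 7 \<and> R' 8 = R 8 \<and> R' 9 = R 10"
      unfolding run_steps_add[of _ _ "10 + 7" 3] run
      using False regs p_word by (simp add: exec_simps del: One_nat_def add_2_eq_Suc')
    then show ?thesis using False by (intro exI[of _ "10 + 7 + 3"]) simp
  qed
qed

lemma exec_select:
  assumes regs: "R 2 = 1" "R 3 = 16" "R 16 = 0"
    and w: "0 < w" "16 < (2::nat) ^ w" "length M < 2 ^ w"
    and c: "R 7 + 2 < length M"
    and hi: "hi = M ! (R 7 + 2)" "hi * 16 + 16 \<le> length M"
    and i: "i = (if R 0 < M ! (hi * 16 + 6) then M ! (R 7 + 1) else hi)" "i * 16 + 16 \<le> length M"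
  shows "\<exists>t\<le>14. \<exists>R'. run_steps w phi_program t (41, R, M) = Some (55, R', M) \<and>
    (\<forall>j\<in>{0, 2, 3, 16}. R' j = R j) \<and> R' 15 = 6 \<and> R' 8 = i \<and> R' 9 = M ! (i * 16 + 8)"
proof -
  have run: "run_steps w phi_program 8 (41, R, M) =
      Some (49, R(8 := M ! (R 7 + 1), 7 := R 7 + 2, 9 := hi, 15 := 6, 10 := M ! (hi * 16 + 6)), M)"
    using regs w c hi by (simp add: exec_simps del: One_nat_def add_2_eq_Suc')
  show ?thesis
  proof (cases "R 0 < M ! (hi * 16 + 6)")
    case True
    have "\<exists>R'. run_steps w phi_program (8 + 5) (41, R, M) = Some (55, R', M) \<and>
        (\<forall>j\<in>{0, 2, 3, 16}. R' j = R j) \<and> R' 15 = 6 \<and> R' 8 = i \<and> R' 9 = M ! (i * 16 + 8)"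
      unfolding run_steps_add[of _ _ 8 5] run
      using True regs w i by (simp add: exec_simps del: One_nat_def add_2_eq_Suc')
    then show ?thesis by (intro exI[of _ "8 + 5"]) simp
  next
    case False
    have "\<exists>R'. run_steps w phi_program (8 + 6) (41, R, M) = Some (55, R', M) \<and>
        (\<forall>j\<in>{0, 2, 3, 16}. R' j = R j) \<and> R' 15 = 6 \<and> R' 8 = i \<and> R' 9 = M ! (i * 16 + 8)"
      unfolding run_steps_add[of _ _ 8 6] run
      using False regs w i by (simp add: exec_simps del: One_nat_def add_2_eq_Suc')
    then show ?thesis by (intro exI[of _ "8 + 6"]) simp
  qed
qed

lemma exec_bucket_step:
  assumes regs: "R 3 = 16" "R 15 = 6" "R 16 = 0"
    and w: "0 < w" "16 < (2::nat) ^ w" "length M < 2 ^ w"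
    and mid: "R 10 * 16 + 16 \<le> length M"
  shows "\<exists>R'. run_steps w phi_program 6 (60, R, M) = Some (55, R', M) \<and>
    (\<forall>j\<in>{0, 2, 3, 15, 16}. R' j = R j) \<and>
    (if R 0 < M ! (R 10 * 16 + 6) then R' 8 = R 8 \<and> R' 9 = R 10 else R' 8 = R 10 \<and> R' 9 = R 9)"
  using assms by (simp add: exec_simps del: One_nat_def add_2_eq_Suc')

lemma exec_final:
  assumes regs: "R 2 = 1" "R 3 = 16" "R 15 = 6"
    and w: "0 < w" "16 < (2::nat) ^ w" "length M < 2 ^ w"
    and i: "R 8 * 16 + 16 \<le> length M"
    and x: "M ! (R 8 * 16 + 6) \<le> R 0" "R 0 < 2 ^ w" "M ! (R 8 * 16 + 7) + R 0 < 2 ^ w"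
  shows "\<exists>R'. run_steps w phi_program 7 (68, R, M) = Some (75, R', M) \<and>
    R' 0 = M ! (R 8 * 16 + 7) + (R 0 - M ! (R 8 * 16 + 6))"
proof -
  have "M ! (R 8 * 16 + 7) + R 0 - M ! (R 8 * 16 + 6) < 2 ^ w" using x(3) by linarith
  then show ?thesis
    using assms
    by (simp add: exec_simps add.commute[of "R 8 * 16" 7] del: One_nat_def add_2_eq_Suc')
qed

text \<open>Serves both bisections, with the bounds in registers \<open>a\<close> and
  \<open>b\<close>. Halving may round up, hence the \<open>+ 1\<close>; a gap of at most
  \<open>2 ^ Suc e\<close> still shrinks to at most \<open>2 ^ e\<close>, because
  \<open>2 ^ Suc e + 1\<close> is odd.\<close>

lemma bisection_loop:
  fixes R :: "nat \<Rightarrow> nat"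
  assumes body: "\<And>R. I R \<Longrightarrow> 1 < R b - R a \<Longrightarrow>
      \<exists>t\<le>T. \<exists>R'. run_steps w P t (pc, R, M) = Some (pc, R', M) \<and> I R' \<and> 2 * (R' b - R' a) \<le> R b - R a + 1"
    and "I R" "R b - R a \<le> 2 ^ e"
  shows "\<exists>t\<le>T * e. \<exists>R'. run_steps w P t (pc, R, M) = Some (pc, R', M) \<and> I R' \<and> R' b - R' a \<le> 1"
  using assms(2,3)
proof (induction e arbitrary: R)
  case 0
  then show ?case by (intro exI[of _ 0]) auto
next
  case (Suc e)
  show ?case
  proof (cases "1 < R b - R a")
    case False
    with Suc.prems show ?thesis by (intro exI[of _ 0]) auto
  next
    case True
    obtain t R' where t: "t \<le> T" "run_steps w P t (pc, R, M) = Some (pc, R', M)" "I R'"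
      "2 * (R' b - R' a) \<le> R b - R a + 1"
      using body[OF Suc.prems(1) True] by blast
    have "R' b - R' a \<le> 2 ^ e"
      using t(4) Suc.prems(2) by simp
    then obtain t' R'' where t': "t' \<le> T * e" "run_steps w P t' (pc, R', M) = Some (pc, R'', M)"
      "I R''" "R'' b - R'' a \<le> 1"
      using Suc.IH[OF t(3)] by blast
    have "run_steps w P (t + t') (pc, R, M) = Some (pc, R'', M)"
      unfolding run_steps_add t(2) using t'(2) by simp
    then show ?thesis using t(1) t' by (intro exI[of _ "t + t'"]) auto
  qed
qed


text \<open>The interface between program and tables. \<open>bins\<close> and
  \<open>pos_less\<close> hold for every \<open>v\<close>, so that looking up an absent node stays
  within the memory; \<open>lookup\<close> asks for \<open>0 < v\<close> because free slots carry
  the key 0.\<close>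

locale trie_memory = sampled_trie k m s for k m s +
  fixes w rows :: nat and M :: "nat list" and f :: "nat \<Rightarrow> nat"
  assumes word_size: "3 * k + 11 \<le> w"
    and length_M: "length M = rows * 16" "rows * 16 < 2 ^ w" "m \<le> rows"
    and constants: "M ! 11 = k + 1" "M ! 12 = 2 ^ k"
      "M ! 13 = card (below 0) * (k + 1)" "M ! 14 = card (upto_node 0) * (k + 1)"
    and bins: "mult_hash (2 ^ w) (M ! 10) (M ! 9) v < rows"
    and pos_less: "h = mult_hash (2 ^ w) (M ! 10) (M ! 9) v \<Longrightarrow>
      mult_hash (2 ^ w) (M ! (h * 16 + 1)) (M ! (h * 16)) v + M ! (h * 16 + 2) < rows"
    and lookup: "h = mult_hash (2 ^ w) (M ! 10) (M ! 9) v \<Longrightarrow>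
      p = mult_hash (2 ^ w) (M ! (h * 16 + 1)) (M ! (h * 16)) v + M ! (h * 16 + 2) \<Longrightarrow> 0 < v \<Longrightarrow>
      (M ! (p * 16 + 3) = v) = (v \<in> nodes) \<and> (v \<in> nodes \<longrightarrow>
        M ! (p * 16 + 4) = card (below v) * (k + 1) \<and> M ! (p * 16 + 5) = card (upto_node v) * (k + 1))"
    and keys: "i < m \<Longrightarrow> M ! (i * 16 + 6) = s i" "i < m \<Longrightarrow> M ! (i * 16 + 7) = f i"
      "i < m \<Longrightarrow> M ! (i * 16 + 8) = min (i + (k + 1)) m"
    and value_bound: "i < m \<Longrightarrow> f i < 2 ^ k"
begin

lemma words: "0 < w" "16 < (2::nat) ^ w" "length M < 2 ^ w" "2 ^ k + 2 ^ k \<le> (2::nat) ^ w" "2 * k + 5 < (2::nat) ^ w"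
proof -
  have "(2::nat) ^ (k + 5) \<le> 2 ^ w" using word_size by (intro power_increasing) auto
  moreover have "(2::nat) ^ (k + 5) = 32 * 2 ^ k" by (simp add: power_add)
  moreover have "k < 2 ^ k" "(1::nat) \<le> 2 ^ k" by (simp_all add: less_exp)
  ultimately show "0 < w" "16 < (2::nat) ^ w" "length M < 2 ^ w" "2 ^ k + 2 ^ k \<le> (2::nat) ^ w"
    "2 * k + 5 < (2::nat) ^ w"
    using length_M word_size by linarith+
qed

text \<open>Depth \<open>d\<close> is height \<open>k + 1 - d\<close>: depth 0 is the virtual
  parent, \<open>k + 1\<close> the leaf, and \<open>k + 2\<close> a sentinel below it. Registers 8
  and 9 hold depths, and register 7 points just before the candidates of the node at depth
  \<open>R 8\<close>.\<close>

definition depth_invariant :: "nat \<Rightarrow> (nat \<Rightarrow> nat) \<Rightarrow> bool" where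
  "depth_invariant x R \<longleftrightarrow>
     R 0 = x \<and> R 2 = 1 \<and> R 3 = 16 \<and> R 16 = 0 \<and> R 4 = M ! 9 \<and> R 5 = M ! 10 \<and> R 6 = k + 1 \<and>
     R 17 = 2 ^ k + x \<and> R 8 < R 9 \<and> R 9 \<le> k + 2 \<and> (R 9 = k + 2 \<or> node (k + 1 - R 9) x \<notin> nodes) \<and>
     R 7 + 2 < length M \<and> M ! (R 7 + 1) = card (below (node (k + 1 - R 8) x)) * (k + 1) \<and>
     M ! (R 7 + 2) = card (upto_node (node (k + 1 - R 8) x)) * (k + 1)"

definition bucket_invariant :: "nat \<Rightarrow> (nat \<Rightarrow> nat) \<Rightarrow> bool" where
  "bucket_invariant x R \<longleftrightarrow>
     R 0 = x \<and> R 2 = 1 \<and> R 3 = 16 \<and> R 15 = 6 \<and> R 16 = 0 \<and> R 8 < R 9 \<and> R 9 \<le> m \<and>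
     s (R 8) \<le> x \<and> (R 9 = m \<or> x < s (R 9))"

lemma row_le: "i < rows \<Longrightarrow> i * 16 + 16 \<le> length M"
  using length_M(1) mult_le_mono1[of "i + 1" rows 16] by simp

lemma depth_loop_init:
  assumes x: "x < 2 ^ k"
  shows "\<exists>R. run_steps w phi_program 13 (0, (\<lambda>_. 0)(0 := x), M) = Some (13, R, M) \<and>
    depth_invariant x R \<and> R 9 - R 8 = k + 2"
proof -
  have "0 < rows" using length_M(3) m_pos by simp
  then have "16 \<le> length M" using row_le[of 0] by simp
  then obtain R where R: "run_steps w phi_program 13 (0, (\<lambda>_. 0)(0 := x), M) = Some (13, R, M)"
    "R 0 = x" "R 2 = 1" "R 3 = 16" "R 16 = 0" "R 4 = M ! 9" "R 5 = M ! 10" "R 6 = M ! 11"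
    "R 7 = 12" "R 17 = M ! 12 + x" "R 8 = 0" "R 9 = M ! 11 + 1"
    using exec_init[of w M x] words x constants by auto
  have "node (k + 1) x = 0" using x by (simp add: node_def)
  then have "depth_invariant x R"
    using R constants \<open>16 \<le> length M\<close> by (simp add: depth_invariant_def)
  then show ?thesis using R constants by auto
qed

lemma depth_loop_body:
  assumes x: "x < 2 ^ k" and I: "depth_invariant x R" and gap: "1 < R 9 - R 8"
  shows "\<exists>t\<le>25. \<exists>R'. run_steps w phi_program t (13, R, M) = Some (13, R', M) \<and>
    depth_invariant x R' \<and> 2 * (R' 9 - R' 8) \<le> R 9 - R 8 + 1"
proof -
  note I' = I[unfolded depth_invariant_def]
  define mid where "mid = (R 8 + R 9) div 2"
  define R1 where "R1 = R(10 := mid)"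
  have mid: "R 8 < mid" "mid < R 9" "mid \<le> k + 1" using gap I' by (auto simp: mid_def)
  have run1: "run_steps w phi_program 4 (13, R, M) = Some (18, R1, M)"
    unfolding R1_def mid_def using I' gap words by (intro exec_loop_enter) auto
  define v where "v = node (k + 1 - mid) x"
  define h where "h = mult_hash (2 ^ w) (M ! 10) (M ! 9) v"
  define p where "p = mult_hash (2 ^ w) (M ! (h * 16 + 1)) (M ! (h * 16)) v + M ! (h * 16 + 2)"
  have h_less: "h < rows" unfolding h_def by (rule bins)
  have p_less: "p < rows" unfolding p_def by (rule pos_less[OF h_def])
  have v_pos: "0 < v" unfolding v_def using mid by (intro node_pos) auto
  note look = lookup[OF h_def p_def v_pos]
  have "\<exists>t\<le>21. \<exists>R'. run_steps w phi_program t (18, R1, M) = Some (13, R', M) \<and>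
    (\<forall>i\<in>{0, 2, 3, 4, 5, 6, 16, 17}. R' i = R1 i) \<and>
    (if M ! (p * 16 + 3) = v then R' 7 = p * 16 + 3 \<and> R' 8 = R1 10 \<and> R' 9 = R1 9
     else R' 7 = R1 7 \<and> R' 8 = R1 8 \<and> R' 9 = R1 10)"
  proof (rule exec_lookup)
    show "R1 6 < 2 ^ w" using I' words by (simp add: R1_def)
    show "v = R1 17 div 2 ^ (R1 6 - R1 10)" using I' by (simp add: R1_def v_def node_def)
    show "h = R1 4 * v mod 2 ^ w div R1 5" using I' by (simp add: R1_def h_def mult_hash_def)
    show "p = M ! (h * 16) * v mod 2 ^ w div M ! (h * 16 + 1) + M ! (h * 16 + 2)"
      by (simp add: p_def mult_hash_def)
    show "h * 16 + 16 \<le> length M" "p * 16 + 16 \<le> length M"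
      using h_less p_less by (intro row_le; simp)+
  qed (use I' mid words in \<open>simp_all add: R1_def\<close>)
  then obtain t R' where t: "t \<le> 21" "run_steps w phi_program t (18, R1, M) = Some (13, R', M)"
    and frame: "\<forall>i\<in>{0, 2, 3, 4, 5, 6, 16, 17}. R' i = R1 i"
    and res: "if M ! (p * 16 + 3) = v then R' 7 = p * 16 + 3 \<and> R' 8 = R1 10 \<and> R' 9 = R1 9
     else R' 7 = R1 7 \<and> R' 8 = R1 8 \<and> R' 9 = R1 10"
    by blast
  have run: "run_steps w phi_program (4 + t) (13, R, M) = Some (13, R', M)"
    unfolding run_steps_add run1 using t(2) by simp
  have fr: "R' 0 = x" "R' 2 = 1" "R' 3 = 16" "R' 16 = 0" "R' 4 = M ! 9" "R' 5 = M ! 10"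
    "R' 6 = k + 1" "R' 17 = 2 ^ k + x"
    using frame I' by (simp_all add: R1_def)
  show ?thesis
  proof (cases "v \<in> nodes")
    case True
    then have new: "R' 7 = p * 16 + 3" "R' 8 = mid" "R' 9 = R 9"
      using res look by (simp_all add: R1_def)
    have "p * 16 + 3 + 1 = p * 16 + 4" "p * 16 + 3 + 2 = p * 16 + 5" by simp_all
    then have "depth_invariant x R'"
      unfolding depth_invariant_def fr new
      using I' mid look True row_le[OF p_less]
      by (simp add: v_def add.commute[of "p * 16" 4] add.commute[of "p * 16" 5])
    moreover have "2 * (R' 9 - R' 8) \<le> R 9 - R 8 + 1" unfolding new mid_def by linarith
    ultimately show ?thesis using run t(1) by (intro exI[of _ "4 + t"]) auto
  next
    case False
    then have new: "R' 7 = R 7" "R' 8 = R 8" "R' 9 = mid"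
      using res look by (simp_all add: R1_def)
    have "depth_invariant x R'"
      unfolding depth_invariant_def fr new
      using I' mid False by (simp add: v_def)
    moreover have "2 * (R' 9 - R' 8) \<le> R 9 - R 8 + 1" unfolding new mid_def by linarith
    ultimately show ?thesis using run t(1) by (intro exI[of _ "4 + t"]) auto
  qed
qed

lemma depth_loop_exit:
  assumes x: "x < 2 ^ k" and I: "depth_invariant x R" and gap: "R 9 - R 8 \<le> 1"
  shows "\<exists>t\<le>17. \<exists>R'. run_steps w phi_program t (13, R, M) = Some (55, R', M) \<and>
    bucket_invariant x R' \<and> R' 9 - R' 8 \<le> k + 1"
proof -
  note I' = I[unfolded depth_invariant_def]
  define R1 where "R1 = R(10 := R 9 - R 8)"
  have run1: "run_steps w phi_program 3 (13, R, M) = Some (41, R1, M)"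
    unfolding R1_def using I' gap words by (intro exec_loop_exit) auto
  define j where "j = k + 1 - R 8"
  define v where "v = node j x"
  have next_depth: "R 9 = R 8 + 1" using I' gap by auto
  \<comment> \<open>If register 9 still holds the sentinel, register 8 has reached the leaf;
    otherwise the invariant says that the child is absent.\<close>
  have "j = 0 \<or> node (j - 1) x \<notin> nodes"
    using I' unfolding next_depth j_def by auto
  then have rank: "rank x = (if x < sample (card (upto_node v)) then card (below v) else card (upto_node v))"
    using rank_at_deepest_node[OF x, of j] by (simp add: j_def v_def)
  define hi where "hi = card (upto_node v) * (k + 1)"
  define i where "i = rank x * (k + 1)"
  have hi: "hi < m" unfolding hi_def by (rule sample_index) (rule card_node_sets)
  have i: "i < m" unfolding i_def by (rule bucket)
  have "\<exists>t\<le>14. \<exists>R'. run_steps w phi_program t (41, R1, M) = Some (55, R', M) \<and>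
    (\<forall>j\<in>{0, 2, 3, 16}. R' j = R1 j) \<and> R' 15 = 6 \<and> R' 8 = i \<and> R' 9 = M ! (i * 16 + 8)"
  proof (rule exec_select)
    show "hi = M ! (R1 7 + 2)" using I' by (simp add: R1_def hi_def v_def j_def)
    show "hi * 16 + 16 \<le> length M" "i * 16 + 16 \<le> length M"
      using hi i length_M(3) by (intro row_le; simp)+
    show "i = (if R1 0 < M ! (hi * 16 + 6) then M ! (R1 7 + 1) else hi)"
      unfolding keys(1)[OF hi] i_def rank using I'
      by (simp add: R1_def hi_def sample_def v_def j_def)
  qed (use I' words in \<open>simp_all add: R1_def\<close>)
  then obtain t R' where t: "t \<le> 14" "run_steps w phi_program t (41, R1, M) = Some (55, R', M)"
    and R': "\<forall>j\<in>{0, 2, 3, 16}. R' j = R1 j" "R' 15 = 6" "R' 8 = i" "R' 9 = M ! (i * 16 + 8)"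
    by blast
  have run: "run_steps w phi_program (3 + t) (13, R, M) = Some (55, R', M)"
    unfolding run_steps_add run1 using t(2) by simp
  have nine: "R' 9 = min (i + (k + 1)) m" using R'(4) keys(3)[OF i] by simp
  have "bucket_invariant x R'"
    unfolding bucket_invariant_def nine R'(2,3)
    using R'(1) I' bucket(2,3)[of x] i by (simp add: R1_def i_def)
  moreover have "R' 9 - R' 8 \<le> k + 1" unfolding nine R'(3) by simp
  ultimately show ?thesis using run t(1) by (intro exI[of _ "3 + t"]) auto
qed

lemma bucket_loop_body:
  assumes I: "bucket_invariant x R" and gap: "1 < R 9 - R 8"
  shows "\<exists>t\<le>10. \<exists>R'. run_steps w phi_program t (55, R, M) = Some (55, R', M) \<and>
    bucket_invariant x R' \<and> 2 * (R' 9 - R' 8) \<le> R 9 - R 8 + 1"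
proof -
  note I' = I[unfolded bucket_invariant_def]
  define mid where "mid = (R 8 + R 9) div 2"
  define R1 where "R1 = R(10 := mid)"
  have mid: "R 8 < mid" "mid < R 9" "mid < m" using gap I' by (auto simp: mid_def)
  have "R 8 + R 9 < 2 ^ w" using I' length_M m_pos by linarith
  then have run1: "run_steps w phi_program 4 (55, R, M) = Some (60, R1, M)"
    unfolding R1_def mid_def using I' gap by (intro exec_loop_enter) auto
  have "mid * 16 + 16 \<le> length M" using mid length_M(3) by (intro row_le) simp
  then have "\<exists>R'. run_steps w phi_program 6 (60, R1, M) = Some (55, R', M) \<and>
      (\<forall>j\<in>{0, 2, 3, 15, 16}. R' j = R1 j) \<and>
      (if R1 0 < M ! (R1 10 * 16 + 6) then R' 8 = R1 8 \<and> R' 9 = R1 10 else R' 8 = R1 10 \<and> R' 9 = R1 9)"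
    using I' words by (intro exec_bucket_step) (simp_all add: R1_def)
  then obtain R' where R': "run_steps w phi_program 6 (60, R1, M) = Some (55, R', M)"
      "\<forall>j\<in>{0, 2, 3, 15, 16}. R' j = R1 j"
      "if x < s mid then R' 8 = R 8 \<and> R' 9 = mid else R' 8 = mid \<and> R' 9 = R 9"
    using I' keys(1)[OF mid(3)] by (auto simp: R1_def)
  have run: "run_steps w phi_program (4 + 6) (55, R, M) = Some (55, R', M)"
    unfolding run_steps_add run1 using R'(1) by simp
  have fr: "R' 0 = x" "R' 2 = 1" "R' 3 = 16" "R' 15 = 6" "R' 16 = 0"
    using R'(2) I' by (simp_all add: R1_def)
  have "bucket_invariant x R'"
    unfolding bucket_invariant_def fr using R'(3) I' mid by (cases "x < s mid") simp_all
  moreover have "2 * (R' 9 - R' 8) \<le> R 9 - R 8 + 1"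
  proof (cases "x < s mid")
    case True
    then have new: "R' 8 = R 8" "R' 9 = mid" using R'(3) by simp_all
    show ?thesis unfolding new mid_def by linarith
  next
    case False
    then have new: "R' 8 = mid" "R' 9 = R 9" using R'(3) by simp_all
    show ?thesis unfolding new mid_def by linarith
  qed
  ultimately show ?thesis using run by (intro exI[of _ "4 + 6"]) auto
qed

lemma bucket_loop_exit:
  assumes x: "x < 2 ^ k" and I: "bucket_invariant x R" and gap: "R 9 - R 8 \<le> 1"
  shows "\<exists>R'. run_steps w phi_program 10 (55, R, M) = Some (75, R', M) \<and>
    R' 0 = f (R 8) + (x - s (R 8))"
proof -
  note I' = I[unfolded bucket_invariant_def]
  define R1 where "R1 = R(10 := R 9 - R 8)"
  have "R 9 < 2 ^ w" using I' length_M m_pos by linarith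
  then have run1: "run_steps w phi_program 3 (55, R, M) = Some (68, R1, M)"
    unfolding R1_def using I' gap by (intro exec_loop_exit) auto
  have i: "R 8 < m" using I' by linarith
  have "R 8 * 16 + 16 \<le> length M" using i length_M(3) by (intro row_le) simp
  then have "\<exists>R'. run_steps w phi_program 7 (68, R1, M) = Some (75, R', M) \<and>
      R' 0 = M ! (R1 8 * 16 + 7) + (R1 0 - M ! (R1 8 * 16 + 6))"
    using I' words x keys(1,2)[OF i] value_bound[OF i]
    by (intro exec_final) (simp_all add: R1_def)
  then obtain R' where "run_steps w phi_program 7 (68, R1, M) = Some (75, R', M)"
      "R' 0 = f (R 8) + (x - s (R 8))"
    using I' keys(1,2)[OF i] by (auto simp: R1_def)
  moreover from this have "run_steps w phi_program (3 + 7) (55, R, M) = Some (75, R', M)"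
    unfolding run_steps_add run1 by simp
  ultimately show ?thesis by auto
qed

text \<open>The code outside the rounds takes at most 13 + 17 + 10 steps. A round costs at most 25
  steps on the depths and 10 in a bucket, and \<open>e\<close> rounds suffice for either.\<close>

lemma query:
  assumes x: "x < 2 ^ k" and e: "k + 2 \<le> 2 ^ e"
  shows "\<exists>t\<le>40 + 35 * e. \<exists>i<m. s i \<le> x \<and> (\<forall>j<m. s j \<le> x \<longrightarrow> s j \<le> s i) \<and>
    answers w phi_program M x t (f i + (x - s i))"
proof -
  obtain R0 where R0: "run_steps w phi_program 13 (0, (\<lambda>_. 0)(0 := x), M) = Some (13, R0, M)"
    "depth_invariant x R0" "R0 9 - R0 8 = k + 2"
    using depth_loop_init[OF x] by blast
  obtain t1 R1 where R1: "t1 \<le> 25 * e" "run_steps w phi_program t1 (13, R0, M) = Some (13, R1, M)"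
    "depth_invariant x R1" "R1 9 - R1 8 \<le> 1"
    using bisection_loop[of "depth_invariant x" 9 8 25 w phi_program 13 M R0 e]
      depth_loop_body[OF x] R0(2,3) e by auto
  obtain t2 R2 where R2: "t2 \<le> 17" "run_steps w phi_program t2 (13, R1, M) = Some (55, R2, M)"
    "bucket_invariant x R2" "R2 9 - R2 8 \<le> k + 1"
    using depth_loop_exit[OF x R1(3,4)] by blast
  have "R2 9 - R2 8 \<le> 2 ^ e" using R2(4) e by linarith
  then obtain t3 R3 where R3: "t3 \<le> 10 * e" "run_steps w phi_program t3 (55, R2, M) = Some (55, R3, M)"
    "bucket_invariant x R3" "R3 9 - R3 8 \<le> 1"
    using bisection_loop[of "bucket_invariant x" 9 8 10 w phi_program 55 M R2 e]
      bucket_loop_body R2(3) by auto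
  obtain R4 where R4: "run_steps w phi_program 10 (55, R3, M) = Some (75, R4, M)"
    "R4 0 = f (R3 8) + (x - s (R3 8))"
    using bucket_loop_exit[OF x R3(3,4)] by blast
  note I = R3(3)[unfolded bucket_invariant_def]
  define i where "i = R3 8"
  have nine: "R3 9 = i + 1" using I R3(4) by (auto simp: i_def)
  have i: "i < m" "s i \<le> x" using I by (auto simp: i_def)
  have "s j \<le> s i" if "j < m" "s j \<le> x" for j
  proof (cases "j \<le> i")
    case True
    then show ?thesis using s_less[of j i] i by (cases "j = i") auto
  next
    case False
    then have "i + 1 \<noteq> m" using that by simp
    then have "x < s (i + 1)" using I nine by auto
    moreover have "s (i + 1) \<le> s j" using s_less[of "i + 1" j] that False by (cases "j = i + 1") auto
    ultimately show ?thesis using that by simp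
  qed
  moreover have "run_steps w phi_program (13 + (t1 + (t2 + (t3 + 10)))) (0, (\<lambda>_. 0)(0 := x), M) = Some (75, R4, M)"
    unfolding run_steps_add R0(1) using R1(2) R2(2) R3(2) R4(1) by (simp add: run_steps_add)
  then have "answers w phi_program M x (13 + (t1 + (t2 + (t3 + 10)))) (f i + (x - s i))"
    unfolding answers_def using R4(2) by (intro exI[of _ 75] exI[of _ R4]) (simp add: i_def)
  moreover have "13 + (t1 + (t2 + (t3 + 10))) \<le> 40 + 35 * e" using R1(1) R2(1) R3(1) by linarith
  ultimately show ?thesis using i by blast
qed

end

section \<open>Existence of the memory image\<close>

context sampled_trie
begin

lemma m_le: "m \<le> 2 ^ k"
proof -
  have "inj_on s {..<m}"
    by (rule linorder_inj_onI) (use s_less in force)+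
  moreover have "s ` {..<m} \<subseteq> {..<2 ^ k}" using s_bound by auto
  ultimately have "card {..<m} \<le> card {..<(2::nat) ^ k}" by (intro card_inj_on_le) auto
  then show ?thesis by simp
qed

text \<open>Hashing keys below \<open>2 ^ (k + 1)\<close> asks for a modulus cubic in that bound,
  which \<open>128 * 2 ^ (3 * k)\<close> satisfies; addresses reach
  \<open>16 * (74 * m + 2) \<le> 1216 * 2 ^ k\<close>. A word of \<open>3 * k + 11\<close> bits
  covers both.\<close>

lemma trie_memory_exists:
  assumes f: "\<And>i. i < m \<Longrightarrow> f i < 2 ^ k" and w: "3 * k + 11 \<le> w"
  shows "\<exists>M. trie_memory k m s w (74 * m + 2) M f \<and> (\<forall>x\<in>set M. x < 2 ^ w)"
proof -
  let ?N = "(2::nat) ^ w" and ?Z = "(2::nat) ^ (k + 1)"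
  define rows where "rows = 74 * m + 2"
  have "(2::nat) ^ (3 * k + 11) \<le> ?N" using w by (intro power_increasing) auto
  moreover have "(2::nat) ^ (3 * k + 11) = 2048 * (2 ^ k * 2 ^ k * 2 ^ k)"
    by (simp add: power_add mult.commute[of 3] power_mult power3_eq_cube)
  ultimately have N: "2048 * (2 ^ k * 2 ^ k * 2 ^ k) \<le> ?N" by simp
  have one: "(1::nat) \<le> 2 ^ k" by simp
  have "(2::nat) ^ k * 1 * 1 \<le> 2 ^ k * 2 ^ k * 2 ^ k" by (intro mult_mono) auto
  then have N': "2048 * 2 ^ k \<le> ?N" using N by linarith
  have rows: "rows * 16 < ?N" "m < rows" using m_le m_pos N' one by (simp_all add: rows_def)
  have "?Z * (8 * ?Z * ?Z + 2) \<le> ?Z * (16 * ?Z * ?Z)"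
  proof (rule mult_left_mono)
    have "1 * 1 \<le> ?Z * ?Z" by (intro mult_mono) auto
    then show "8 * ?Z * ?Z + 2 \<le> 16 * ?Z * ?Z" by linarith
  qed simp
  also have "\<dots> = 128 * (2 ^ k * 2 ^ k * 2 ^ k)" by simp
  also have "\<dots> \<le> ?N" using N by linarith
  finally have "?Z * (8 * ?Z * ?Z + 2) \<le> ?N" .
  moreover have "card nodes + 1 \<le> ?Z" using nodes_props(3) m_le one by simp
  ultimately have "\<exists>a L \<alpha> \<Lambda> off.
    a < ?N \<and> 0 < L \<and> L < ?N \<and> (\<forall>i. \<alpha> i < ?N \<and> 0 < \<Lambda> i \<and> \<Lambda> i < ?N) \<and>
    (\<forall>x. mult_hash ?N L a x \<le> card nodes \<and> off (mult_hash ?N L a x) \<le> 74 * card nodes + 2) \<and>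
    (\<forall>x. off (mult_hash ?N L a x) +
       mult_hash ?N (\<Lambda> (mult_hash ?N L a x)) (\<alpha> (mult_hash ?N L a x)) x < 74 * card nodes + 2) \<and>
    inj_on (\<lambda>x. off (mult_hash ?N L a x) +
       mult_hash ?N (\<Lambda> (mult_hash ?N L a x)) (\<alpha> (mult_hash ?N L a x)) x) nodes"
    by (rule perfect_hashing[OF nodes_props(1,2)])
  then obtain a L \<alpha> \<Lambda> off where hash: "a < ?N" "0 < L" "L < ?N"
      "\<forall>i. \<alpha> i < ?N \<and> 0 < \<Lambda> i \<and> \<Lambda> i < ?N"
      "\<forall>x. mult_hash ?N L a x \<le> card nodes \<and> off (mult_hash ?N L a x) \<le> 74 * card nodes + 2"
      "\<forall>x. off (mult_hash ?N L a x) +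
        mult_hash ?N (\<Lambda> (mult_hash ?N L a x)) (\<alpha> (mult_hash ?N L a x)) x < 74 * card nodes + 2"
    and inj: "inj_on (\<lambda>x. off (mult_hash ?N L a x) +
       mult_hash ?N (\<Lambda> (mult_hash ?N L a x)) (\<alpha> (mult_hash ?N L a x)) x) nodes"
    by (elim exE conjE) (rule that)
  define pos where "pos x = off (mult_hash ?N L a x) +
       mult_hash ?N (\<Lambda> (mult_hash ?N L a x)) (\<alpha> (mult_hash ?N L a x)) x" for x
  have inj_pos: "inj_on pos nodes" using inj by (simp add: pos_def[abs_def])
  have pos_rows: "pos x < rows" for x
    using hash(6)[rule_format, of x] nodes_props(3) unfolding pos_def rows_def by linarith
  \<comment> \<open>Free slots get 0, which is no trie node, so comparing the stored key with a
    positive \<open>v\<close> decides membership.\<close>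
  define key where "key p = (if p \<in> pos ` nodes then inv_into nodes pos p else 0)" for p
  have key_pos: "(key (pos v) = v) = (v \<in> nodes)" if "0 < v" for v
  proof (cases "v \<in> nodes")
    case True
    then show ?thesis using inj_pos by (simp add: key_def)
  next
    case False
    show ?thesis
    proof (cases "pos v \<in> pos ` nodes")
      case True
      then have "key (pos v) \<in> nodes" unfolding key_def by (simp only: if_True inv_into_into)
      then show ?thesis using False by metis
    qed (use that False in \<open>simp add: key_def\<close>)
  qed
  have key_less: "key p < ?N" for p
  proof -
    have "key p < ?Z"
      using inv_into_into[of p pos nodes] nodes_props(2) by (auto simp: key_def)
    also have "?Z \<le> ?N" using N' by simp
    finally show ?thesis .
  qed
  define F where "F i = [\<alpha> i, \<Lambda> i, off i, key i, card (below (key i)) * (k + 1),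
    card (upto_node (key i)) * (k + 1), if i < m then s i else 0, if i < m then f i else 0,
    min (i + (k + 1)) m, a, L, k + 1, 2 ^ k, card (below 0) * (k + 1), card (upto_node 0) * (k + 1), 0]" for i
  \<comment> \<open>Reduction by the word size makes every cell a word by construction. The entries
    that a query relies on are shown below to be smaller, so they are stored unchanged.\<close>
  define M where "M = map (\<lambda>t. F (t div 16) ! (t mod 16) mod ?N) [0..<rows * 16]"
  have M: "M ! (i * 16 + c) = F i ! c mod ?N" if "i < rows" "c < 16" for i c
  proof -
    have "i * 16 + c < rows * 16" using that by linarith
    moreover have "(i * 16 + c) div 16 = i" "(i * 16 + c) mod 16 = c" using that by simp_all
    ultimately show ?thesis by (simp add: M_def)
  qed
  have M0: "M ! c = F 0 ! c mod ?N" if "c < 16" for c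
    using M[of 0 c] that rows by simp
  have node_sets: "card (below v) * (k + 1) < ?N" "card (upto_node v) * (k + 1) < ?N" for v
  proof -
    have "card (below v) * (k + 1) \<le> num_samples * (k + 1)"
      "card (upto_node v) * (k + 1) \<le> num_samples * (k + 1)"
      using card_node_sets by (intro mult_right_mono; simp)+
    then show "card (below v) * (k + 1) < ?N" "card (upto_node v) * (k + 1) < ?N"
      using num_samples_le m_le N' one by linarith+
  qed
  have k: "k + 1 < ?N" "(2::nat) ^ k < ?N" using less_exp[of k] N' one by linarith+
  have header: "M ! 9 = a" "M ! 10 = L" "M ! 11 = k + 1" "M ! 12 = 2 ^ k"
    "M ! 13 = card (below 0) * (k + 1)" "M ! 14 = card (upto_node 0) * (k + 1)"
    using M0[of 9] M0[of 10] M0[of 11] M0[of 12] M0[of 13] M0[of 14] hash(1,3) k node_sets[of 0]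
    by (simp_all add: F_def)
  have bin_rows: "mult_hash ?N L a v < rows" for v
    using hash(5)[rule_format, of v] nodes_props(3) rows by linarith
  have bins: "M ! (mult_hash ?N L a v * 16) = \<alpha> (mult_hash ?N L a v)"
    "M ! (mult_hash ?N L a v * 16 + 1) = \<Lambda> (mult_hash ?N L a v)"
    "M ! (mult_hash ?N L a v * 16 + 2) = off (mult_hash ?N L a v)" for v
  proof -
    have "off (mult_hash ?N L a v) < ?N"
    proof -
      have "off (mult_hash ?N L a v) \<le> rows"
        using hash(5)[rule_format, of v] nodes_props(3) unfolding rows_def by simp
      also have "rows \<le> rows * 16" by simp
      finally show ?thesis using rows(1) by (rule le_less_trans)
    qed
    then show "M ! (mult_hash ?N L a v * 16) = \<alpha> (mult_hash ?N L a v)"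
      "M ! (mult_hash ?N L a v * 16 + 1) = \<Lambda> (mult_hash ?N L a v)"
      "M ! (mult_hash ?N L a v * 16 + 2) = off (mult_hash ?N L a v)"
      using M[OF bin_rows[of v], of 0] M[OF bin_rows[of v], of 1] M[OF bin_rows[of v], of 2] hash(4)
      by (simp_all add: F_def del: add_2_eq_Suc')
  qed
  have entries: "M ! (p * 16 + 3) = key p" "M ! (p * 16 + 4) = card (below (key p)) * (k + 1)"
    "M ! (p * 16 + 5) = card (upto_node (key p)) * (k + 1)" if "p < rows" for p
    using M[OF that, of 3] M[OF that, of 4] M[OF that, of 5] key_less[of p] node_sets[of "key p"]
    by (simp_all add: F_def)
  have rest: "M ! (i * 16 + 6) = s i" "M ! (i * 16 + 7) = f i" "M ! (i * 16 + 8) = min (i + (k + 1)) m"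
    if "i < m" for i
  proof -
    have "s i < ?N" "f i < ?N" "min (i + (k + 1)) m < ?N" "i < rows"
      using s_bound[OF that] f[OF that] that k rows m_le by linarith+
    then show "M ! (i * 16 + 6) = s i" "M ! (i * 16 + 7) = f i" "M ! (i * 16 + 8) = min (i + (k + 1)) m"
      using M[of i 6] M[of i 7] M[of i 8] that by (simp_all add: F_def)
  qed
  have "trie_memory k m s w rows M f"
  proof (rule trie_memory.intro[OF sampled_trie_axioms], unfold_locales)
    show "length M = rows * 16" by (simp add: M_def)
    show "m \<le> rows" using rows by simp
    fix v h p
    show "mult_hash ?N (M ! 10) (M ! 9) v < rows" unfolding header by (rule bin_rows)
    assume h: "h = mult_hash ?N (M ! 10) (M ! 9) v"
    have pos: "mult_hash ?N (M ! (h * 16 + 1)) (M ! (h * 16)) v + M ! (h * 16 + 2) = pos v"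
      unfolding h header bins pos_def by (rule add.commute)
    show "mult_hash ?N (M ! (h * 16 + 1)) (M ! (h * 16)) v + M ! (h * 16 + 2) < rows"
      unfolding pos by (rule pos_rows)
    assume p: "p = mult_hash ?N (M ! (h * 16 + 1)) (M ! (h * 16)) v + M ! (h * 16 + 2)" and v: "0 < v"
    show "(M ! (p * 16 + 3) = v) = (v \<in> nodes) \<and> (v \<in> nodes \<longrightarrow>
        M ! (p * 16 + 4) = card (below v) * (k + 1) \<and> M ! (p * 16 + 5) = card (upto_node v) * (k + 1))"
      unfolding p pos entries[OF pos_rows] using key_pos[OF v] by (cases "v \<in> nodes") simp_all
  qed (use w rows header rest f in simp_all)
  moreover have "\<forall>x\<in>set M. x < ?N" by (auto simp: M_def)
  ultimately show ?thesis unfolding rows_def by blast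
qed

end

section \<open>Where \<open>\<phi>\<close> continues linearly\<close>

lemma precedes_irrefl [simp]: "\<not> precedes \<pi> x x"
  by (simp add: precedes_def)

lemma precedes_imp_in: "precedes \<pi> x y \<Longrightarrow> (x, y) \<in> \<pi>"
  by (simp add: precedes_def)

lemma precedes_trans:
  assumes "linear_order_on A \<pi>" "precedes \<pi> x y" "precedes \<pi> y z"
  shows "precedes \<pi> x z"
  using assms
  unfolding precedes_def linear_order_on_def partial_order_on_def preorder_on_def
  by (metis antisymD transD)

lemma precedes_asym:
  assumes "linear_order_on A \<pi>" "precedes \<pi> x y"
  shows "(y, x) \<notin> \<pi>"
  using assms unfolding precedes_def linear_order_on_def partial_order_on_def
  by (metis antisymD)

lemma precedes_cases:
  assumes "linear_order_on A \<pi>" "x \<in> A" "y \<in> A"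
  shows "precedes \<pi> x y \<or> x = y \<or> precedes \<pi> y x"
  using assms unfolding precedes_def linear_order_on_def total_on_def by metis

lemma precedes_in:
  assumes "linear_order_on A \<pi>" "precedes \<pi> x y"
  shows "x \<in> A" "y \<in> A"
  using assms
  unfolding precedes_def linear_order_on_def partial_order_on_def preorder_on_def
  by auto

lemma immediately_precedes_unique_left:
  assumes "linear_order_on A \<pi>" "immediately_precedes \<pi> x z" "immediately_precedes \<pi> y z"
  shows "x = y"
  using assms precedes_cases[OF assms(1), of x y] precedes_in[OF assms(1)]
  unfolding immediately_precedes_def by metis

lemma immediately_precedes_unique_right:
  assumes "linear_order_on A \<pi>" "immediately_precedes \<pi> x y" "immediately_precedes \<pi> x z"
  shows "y = z"
  using assms precedes_cases[OF assms(1), of y z] precedes_in[OF assms(1)]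
  unfolding immediately_precedes_def by metis

lemma immediately_precedes_exists:
  assumes lin: "linear_order_on A \<pi>" and fin: "finite A" and prec: "precedes \<pi> x y"
  shows "\<exists>z. immediately_precedes \<pi> z y"
proof -
  define rk where "rk z = card {a \<in> A. precedes \<pi> a z}" for z
  define S where "S = {a \<in> A. precedes \<pi> a y}"
  have "x \<in> S" "finite S"
    using prec precedes_in[OF lin prec] fin by (auto simp: S_def)
  then have "Max (rk ` S) \<in> rk ` S" by (intro Max_in) auto
  then obtain z where z: "z \<in> S" "rk z = Max (rk ` S)" by force
  have rk_less: "rk a < rk b" if "precedes \<pi> a b" for a b
    unfolding rk_def
  proof (rule psubset_card_mono)
    show "{c \<in> A. precedes \<pi> c a} \<subset> {c \<in> A. precedes \<pi> c b}"
    proof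
      show "{c \<in> A. precedes \<pi> c a} \<subseteq> {c \<in> A. precedes \<pi> c b}"
        using precedes_trans[OF lin _ that] by auto
      have "a \<in> {c \<in> A. precedes \<pi> c b}" "a \<notin> {c \<in> A. precedes \<pi> c a}"
        using that precedes_in[OF lin that] by auto
      then show "{c \<in> A. precedes \<pi> c a} \<noteq> {c \<in> A. precedes \<pi> c b}" by metis
    qed
  qed (use fin in auto)
  have "immediately_precedes \<pi> z y"
    unfolding immediately_precedes_def
  proof (intro conjI notI)
    show "precedes \<pi> z y" using z(1) by (simp add: S_def)
    assume "\<exists>c. precedes \<pi> z c \<and> precedes \<pi> c y"
    then obtain c where c: "precedes \<pi> z c" "precedes \<pi> c y" by blast
    then have "c \<in> S" using precedes_in[OF lin c(2)] by (simp add: S_def)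
    then have "rk c \<le> Max (rk ` S)" using \<open>finite S\<close> by (intro Max_ge) auto
    then show False using z(2) rk_less[OF c(1)] by simp
  qed
  then show ?thesis ..
qed

lemma finite_runs: "finite (runs B)"
proof (rule finite_subset)
  show "runs B \<subseteq> {(i, j). i < j \<and> j \<le> length B}" unfolding runs_def by blast
  show "finite {(i, j). i < j \<and> j \<le> length B}"
    by (rule finite_subset[of _ "{..length B} \<times> {..length B}"]) auto
qed

text \<open>Gives each position at which the character changes a run of its own, so that such
  positions can be counted by \<open>runs B\<close>.\<close>

lemma run_starts:
  assumes "i < length B" "0 < i \<longrightarrow> B ! (i - 1) \<noteq> B ! i"
  shows "\<exists>j. (i, j) \<in> runs B"
proof -
  let ?P = "\<lambda>j. i < j \<and> (j = length B \<or> B ! j \<noteq> B ! i)"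
  define j where "j = (LEAST j. ?P j)"
  have P: "?P (length B)" using assms(1) by simp
  have j: "?P j" unfolding j_def by (rule LeastI[of ?P, OF P])
  have le: "j \<le> length B" unfolding j_def by (rule Least_le[of ?P, OF P])
  have "B ! k = B ! i" if "i \<le> k" "k < j" for k
    using not_less_Least[of k ?P] that unfolding j_def[symmetric] by (cases "k = i") auto
  then have "\<forall>k\<in>{i..<j}. B ! k = B ! i" by (meson atLeastLessThan_iff)
  moreover have "j < length B \<longrightarrow> B ! j \<noteq> B ! i" using j by blast
  ultimately have "(i, j) \<in> runs B"
    using j le assms unfolding runs_def by blast
  then show ?thesis ..
qed

lemma in_set_butlast_tl:
  assumes "x \<in> set xs" "x \<noteq> hd xs" "x \<noteq> last xs"
  shows "x \<in> set (butlast (tl xs))"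
proof -
  have "x \<in> set (tl xs)"
    using assms(1,2) by (cases xs) auto
  moreover have "last (tl xs) = last xs"
    using calculation by (cases xs) auto
  ultimately show ?thesis
    using assms(3) by (cases "tl xs" rule: rev_cases) auto
qed

locale decomposed_wheeler_graph = fin_digraph G for G :: "('v, 'e) pre_digraph" (structure) +
  fixes lab :: "'e \<Rightarrow> 'c::linorder" and \<pi> :: "'v rel" and B :: "'c list"
    and D :: "('v \<times> 'e list) set" and ident :: "'v \<Rightarrow> nat"
  assumes wheeler: "wheeler_order G lab \<pi>"
    and bwt: "is_BWT G lab \<pi> B"
    and decomposition: "path_decomposition G D"
    and identifiers: "identifiers G ident"
    and compatible: "compatible_identifiers G D ident"
begin

lemma linear: "linear_order_on (verts G) \<pi>"
  using wheeler by (simp add: wheeler_order_def)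

definition Ends :: "'v set" where
  "Ends = (\<Union>p\<in>D. path_endpoints G p)"

lemma finite_D: "finite D"
  using decomposition by (simp add: path_decomposition_def)

lemma card_Ends: "finite Ends" "card Ends \<le> 2 * card D"
proof -
  show "finite Ends" unfolding Ends_def using finite_D by (auto simp: path_endpoints_def)
  have "card Ends \<le> (\<Sum>p\<in>D. card (path_endpoints G p))"
    unfolding Ends_def by (rule card_UN_le[OF finite_D])
  also have "\<dots> \<le> (\<Sum>p\<in>D. 2)"
    by (rule sum_mono) (auto simp: path_endpoints_def card_insert_if)
  finally show "card Ends \<le> 2 * card D" by simp
qed

lemma internal_degrees:
  assumes "p \<in> D" "v \<in> path_internal G p"
  shows "in_degree G v = 1" "out_degree G v = 1"
  using decomposition assms unfolding path_decomposition_def by blast+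

lemma non_endpoint_degrees:
  assumes "v \<in> verts G" "v \<notin> Ends"
  shows "in_degree G v = 1" "out_degree G v = 1"
proof -
  obtain p where p: "p \<in> D" "v \<in> set (path_verts G p)"
    using decomposition assms(1) unfolding path_decomposition_def by blast
  have "v \<in> path_internal G p"
    using p assms(2) in_set_butlast_tl[of v "path_verts G p"]
    by (auto simp: Ends_def path_endpoints_def path_internal_def)
  then show "in_degree G v = 1" "out_degree G v = 1"
    using internal_degrees p(1) by blast+
qed

lemma arc_on_path:
  assumes "e \<in> arcs G"
  obtains p i v where "p \<in> D" "i < length (snd p)" "snd p ! i = e" "cas (fst p) (snd p) v"
proof -
  obtain p where p: "p \<in> D" "e \<in> set (snd p)"
    using decomposition assms unfolding path_decomposition_def by blast
  have "directed_path G p"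
    using p decomposition unfolding path_decomposition_def by blast
  then obtain v where "cas (fst p) (snd p) v"
    by (auto simp: directed_path_def apath_def awalk_def)
  with p show ?thesis using that by (metis in_set_conv_nth)
qed

text \<open>Naming the exception by its arc and not by its tail leaves at most one exception per
  path.\<close>

lemma tail_internal_or_first:
  assumes "e \<in> arcs G"
  shows "out_degree G (tail G e) = 1 \<or> e \<in> (\<lambda>p. hd (snd p)) ` D"
proof -
  obtain p i v where p: "p \<in> D" "i < length (snd p)" "snd p ! i = e" "cas (fst p) (snd p) v"
    using arc_on_path[OF assms] .
  show ?thesis
  proof (cases "i = 0")
    case True
    then have "e = hd (snd p)" using p by (simp add: hd_conv_nth)
    with p(1) show ?thesis by blast
  next
    case False
    have "path_verts G p = map (tail G) (snd p) @ [head G (last (snd p))]"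
      using p(2) by (auto simp: path_verts_def awalk_verts_conv)
    then have "butlast (tl (path_verts G p)) = map (tail G) (tl (snd p))"
      using p(2) by (cases "snd p") (auto simp: butlast_append)
    moreover have "e \<in> set (tl (snd p))"
      using False p by (cases "snd p") (auto simp: nth_Cons')
    ultimately have "tail G e \<in> path_internal G p"
      by (auto simp: path_internal_def)
    then show ?thesis using internal_degrees p(1) by blast
  qed
qed

lemma head_internal_or_last:
  assumes "e \<in> arcs G"
  shows "in_degree G (head G e) = 1 \<or> e \<in> (\<lambda>p. last (snd p)) ` D"
proof -
  obtain p i v where p: "p \<in> D" "i < length (snd p)" "snd p ! i = e" "cas (fst p) (snd p) v"
    using arc_on_path[OF assms] .
  show ?thesis
  proof (cases "i = length (snd p) - 1")
    case True
    then have "e = last (snd p)" using p by (metis last_conv_nth length_0_conv not_less0)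
    with p(1) show ?thesis by blast
  next
    case False
    have "path_verts G p = tail G (hd (snd p)) # map (head G) (snd p)"
      using p(2) by (auto simp: path_verts_def awalk_verts_conv'[OF p(4)])
    then have "butlast (tl (path_verts G p)) = map (head G) (butlast (snd p))"
      by (simp add: map_butlast)
    moreover have "e \<in> set (butlast (snd p))"
      using False p(2,3) by (metis One_nat_def Suc_pred in_set_conv_nth length_butlast
        length_greater_0_conv less_antisym list.size(3) not_less_zero nth_butlast)
    ultimately have "head G e \<in> path_internal G p"
      by (auto simp: path_internal_def)
    then show ?thesis using internal_degrees p(1) by blast
  qed
qed

text \<open>Meaningful only for vertices of out-degree (in-degree) 1.\<close>

definition out_arc :: "'v \<Rightarrow> 'e" where
  "out_arc v = (THE e. e \<in> arcs G \<and> tail G e = v)"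

definition in_arc :: "'v \<Rightarrow> 'e" where
  "in_arc v = (THE e. e \<in> arcs G \<and> head G e = v)"

lemma out_arc_eq:
  assumes "e \<in> arcs G" "out_degree G (tail G e) = 1"
  shows "out_arc (tail G e) = e"
proof -
  obtain a where a: "out_arcs G (tail G e) = {a}"
    using assms(2) by (auto simp: out_degree_def card_1_singleton_iff)
  then have *: "x \<in> arcs G \<and> tail G x = tail G e \<longleftrightarrow> x = a" for x
    by (auto simp: set_eq_iff)
  then have "a = e" using assms(1) by metis
  then show ?thesis unfolding out_arc_def * by simp
qed

lemma in_arc_eq:
  assumes "e \<in> arcs G" "in_degree G (head G e) = 1"
  shows "in_arc (head G e) = e"
proof -
  obtain a where a: "in_arcs G (head G e) = {a}"
    using assms(2) by (auto simp: in_degree_def card_1_singleton_iff)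
  then have *: "x \<in> arcs G \<and> head G x = head G e \<longleftrightarrow> x = a" for x
    by (auto simp: set_eq_iff)
  then have "a = e" using assms(1) by metis
  then show ?thesis unfolding in_arc_def * by simp
qed

lemma out_arc_props:
  assumes "v \<in> verts G" "out_degree G v = 1"
  shows "out_arc v \<in> arcs G" "tail G (out_arc v) = v"
proof -
  obtain a where "out_arcs G v = {a}"
    using assms(2) by (auto simp: out_degree_def card_1_singleton_iff)
  then have "a \<in> arcs G \<and> tail G a = v" by (auto simp: set_eq_iff)
  moreover from this have "out_arc v = a" using out_arc_eq[of a] assms(2) by auto
  ultimately show "out_arc v \<in> arcs G" "tail G (out_arc v) = v" by simp_all
qed

lemma in_arc_props:
  assumes "v \<in> verts G" "in_degree G v = 1"
  shows "in_arc v \<in> arcs G" "head G (in_arc v) = v"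
proof -
  obtain a where "in_arcs G v = {a}"
    using assms(2) by (auto simp: in_degree_def card_1_singleton_iff)
  then have "a \<in> arcs G \<and> head G a = v" by (auto simp: set_eq_iff)
  moreover from this have "in_arc v = a" using in_arc_eq[of a] assms(2) by auto
  ultimately show "in_arc v \<in> arcs G" "head G (in_arc v) = v" by simp_all
qed

text \<open>Leads back from \<open>u'\<close> to \<open>u\<close>, so that an exception at
  \<open>u'\<close> can be charged by a function of \<open>u'\<close>.\<close>

definition order_succ :: "'v \<Rightarrow> 'v" where
  "order_succ u = (THE v. immediately_precedes \<pi> u v)"

lemma order_succ_eq: "immediately_precedes \<pi> u v \<Longrightarrow> order_succ u = v"
  unfolding order_succ_def
  by (rule the_equality) (auto intro: immediately_precedes_unique_right[OF linear])

text \<open>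
  A vertex strictly between the two heads would be the head of an arc that carries the same label and
  therefore, by the order axioms, starts at one of the two tails.
\<close>

lemma immediately_precedes_heads:
  assumes e: "e \<in> arcs G" and e': "e' \<in> arcs G" and lab: "lab e' = lab e"
    and imm: "immediately_precedes \<pi> (tail G e') (tail G e)"
    and deg: "out_degree G (tail G e) = 1" "out_degree G (tail G e') = 1"
    and "in_degree G (head G e) = 1"
  shows "immediately_precedes \<pi> (head G e') (head G e)"
proof -
  let ?u = "tail G e" and ?u' = "tail G e'" and ?v = "head G e" and ?v' = "head G e'"
  note W = wheeler[unfolded wheeler_order_def]
  have lt: "lab a < lab b \<Longrightarrow> precedes \<pi> (head G a) (head G b)"
    and eq: "lab a = lab b \<Longrightarrow> precedes \<pi> (tail G a) (tail G b) \<Longrightarrow> (head G a, head G b) \<in> \<pi>"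
    if "a \<in> arcs G" "b \<in> arcs G" for a b
    using W that by blast+
  have first: "precedes \<pi> a b"
    if "a \<in> verts G" "b \<in> verts G" "in_degree G a = 0" "in_degree G b \<noteq> 0" for a b
    using W that by blast
  have prec: "precedes \<pi> ?u' ?u" using imm by (simp add: immediately_precedes_def)
  \<comment> \<open>Equal heads would make both arcs the only in-arc of that vertex, yet their tails
    differ.\<close>
  have "?v' \<noteq> ?v"
    using in_arc_eq[OF e assms(7)] in_arc_eq[OF e'] assms(7) prec by (metis precedes_irrefl)
  moreover have "(?v', ?v) \<in> \<pi>" using eq[OF e' e lab prec] .
  ultimately have "precedes \<pi> ?v' ?v" by (simp add: precedes_def)
  moreover have False if x: "precedes \<pi> ?v' x" "precedes \<pi> x ?v" for x
  proof -
    have xv: "x \<in> verts G" using precedes_in[OF linear x(1)] by simp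
    have in_v': "in_degree G ?v' \<noteq> 0"
    proof -
      have "e' \<in> in_arcs G ?v'" using e' by simp
      then show ?thesis unfolding in_degree_def by (metis card_0_eq empty_iff finite_in_arcs)
    qed
    \<comment> \<open>Vertices of in-degree 0 come first in \<pi>, so none of them can follow
      \<open>?v'\<close>, which has an in-arc.\<close>
    have "in_degree G x \<noteq> 0"
    proof
      assume "in_degree G x = 0"
      from first[OF xv head_in_verts[OF e'] this in_v'] show False
        using precedes_asym[OF linear x(1)] by (simp add: precedes_def)
    qed
    then have "in_arcs G x \<noteq> {}" unfolding in_degree_def by (metis card.empty)
    then obtain a where "a \<in> in_arcs G x" by blast
    then have a: "a \<in> arcs G" "head G a = x" by simp_all
    have labs: "lab a = lab e"
    proof (rule linorder_cases[of "lab a" "lab e"])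
      assume "lab a < lab e"
      then have "precedes \<pi> x ?v'" using lt[OF a(1) e'] a(2) lab by simp
      then show ?thesis using precedes_asym[OF linear x(1)] by (simp add: precedes_def)
    next
      assume "lab e < lab a"
      then have "precedes \<pi> ?v x" using lt[OF e a(1)] a(2) by simp
      then show ?thesis using precedes_asym[OF linear x(2)] by (simp add: precedes_def)
    qed
    consider "precedes \<pi> (tail G a) ?u'" | "tail G a = ?u'" | "tail G a = ?u" | "precedes \<pi> ?u (tail G a)"
      using imm precedes_cases[OF linear tail_in_verts[OF a(1)] tail_in_verts[OF e]]
        precedes_cases[OF linear tail_in_verts[OF a(1)] tail_in_verts[OF e']]
      unfolding immediately_precedes_def by blast
    then show False
    proof cases
      case 1
      then have "(x, ?v') \<in> \<pi>" using eq[OF a(1) e'] labs lab a(2) by metis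
      then show ?thesis using precedes_asym[OF linear x(1)] by contradiction
    next
      case 2
      then have "a = e'" using out_arc_eq[OF a(1)] out_arc_eq[OF e'] deg by metis
      then show ?thesis using a(2) x(1) precedes_irrefl by metis
    next
      case 3
      then have "a = e" using out_arc_eq[OF a(1)] out_arc_eq[OF e] deg by metis
      then show ?thesis using a(2) x(2) precedes_irrefl by metis
    next
      case 4
      then have "(?v, x) \<in> \<pi>" using eq[OF e a(1)] labs a(2) by metis
      then show ?thesis using precedes_asym[OF linear x(2)] by contradiction
    qed
  qed
  ultimately show ?thesis by (auto simp: immediately_precedes_def)
qed

text \<open>A listing that yields \<open>B\<close>, fixed once so that run starts can be traced back
  to arcs.\<close>

definition bwt_arcs :: "'e list" where
  "bwt_arcs = (SOME es. distinct es \<and> set es = arcs G \<and>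
     sorted_wrt (\<lambda>e e'. precedes \<pi> (tail G e) (tail G e') \<or>
       tail G e = tail G e' \<and> (head G e, head G e') \<in> \<pi>) es \<and> B = map lab es)"

lemma bwt_arcs:
  "distinct bwt_arcs" "set bwt_arcs = arcs G" "B = map lab bwt_arcs"
  "i < j \<Longrightarrow> j < length bwt_arcs \<Longrightarrow>
     precedes \<pi> (tail G (bwt_arcs ! i)) (tail G (bwt_arcs ! j)) \<or>
     tail G (bwt_arcs ! i) = tail G (bwt_arcs ! j)"
  using bwt[unfolded is_BWT_def, folded some_eq_ex, folded bwt_arcs_def]
  by (auto simp: sorted_wrt_iff_nth_less)

text \<open>The tails are neighbours in \<pi> and each has a single out-arc, so \<open>e'\<close>
  and \<open>e\<close> are adjacent in the listing.\<close>

lemma label_change_starts_run: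
  assumes e: "e \<in> arcs G" and e': "e' \<in> arcs G" and lab: "lab e' \<noteq> lab e"
    and imm: "immediately_precedes \<pi> (tail G e') (tail G e)"
    and deg: "out_degree G (tail G e) = 1" "out_degree G (tail G e') = 1"
  shows "e \<in> (\<lambda>x. bwt_arcs ! fst x) ` runs B"
proof -
  obtain i where i: "i < length bwt_arcs" "bwt_arcs ! i = e"
    using e bwt_arcs(2) by (metis in_set_conv_nth)
  obtain i' where i': "i' < length bwt_arcs" "bwt_arcs ! i' = e'"
    using e' bwt_arcs(2) by (metis in_set_conv_nth)
  have prec: "precedes \<pi> (tail G e') (tail G e)" using imm by (simp add: immediately_precedes_def)
  have "e \<noteq> e'" using lab by auto
  have "\<not> i < i'"
    using bwt_arcs(4)[of i i'] i i' prec precedes_asym[OF linear prec] precedes_imp_in by fastforce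
  moreover have "i \<noteq> i'" using \<open>e \<noteq> e'\<close> i i' by auto
  ultimately have "i' < i" by simp
  have "i - 1 = i'"
  proof (rule ccontr)
    assume "i - 1 \<noteq> i'"
    with \<open>i' < i\<close> have m: "i' < i - 1" "i - 1 < i" by auto
    define a where "a = bwt_arcs ! (i - 1)"
    have a: "a \<in> arcs G" using i(1) bwt_arcs(2) unfolding a_def
      by (metis less_imp_diff_less nth_mem)
    have "precedes \<pi> (tail G e') (tail G a) \<or> tail G e' = tail G a"
      using bwt_arcs(4)[OF m(1)] i i' by (simp add: a_def)
    moreover have "precedes \<pi> (tail G a) (tail G e) \<or> tail G a = tail G e"
      using bwt_arcs(4)[OF m(2)] i by (simp add: a_def)
    ultimately have "tail G a = tail G e' \<or> tail G a = tail G e"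
      using imm unfolding immediately_precedes_def by metis
    then have "a = e \<or> a = e'"
      using out_arc_eq[OF a] out_arc_eq[OF e] out_arc_eq[OF e'] deg by metis
    then have "i - 1 = i \<or> i - 1 = i'"
      using i i' bwt_arcs(1) by (metis a_def less_imp_diff_less nth_eq_iff_index_eq)
    then show False using m by simp
  qed
  have "B ! i = lab e" "B ! i' = lab e'" using i i' bwt_arcs(3) by (metis nth_map)+
  with \<open>i - 1 = i'\<close> lab have "B ! (i - 1) \<noteq> B ! i" by simp
  then obtain j where "(i, j) \<in> runs B"
    using run_starts[of i B] i(1) bwt_arcs(3) by (metis length_map)
  then show ?thesis using i(2) by (intro image_eqI[of _ _ "(i, j)"]) simp_all
qed

definition has_pred :: "'v \<Rightarrow> bool" where
  "has_pred v \<longleftrightarrow> (\<exists>u. immediately_precedes \<pi> u v)"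

lemma immediately_precedes_verts:
  assumes "immediately_precedes \<pi> u v"
  shows "u \<in> verts G" "v \<in> verts G"
  using assms precedes_in[OF linear] by (auto simp: immediately_precedes_def)

lemma phi_ident:
  assumes "immediately_precedes \<pi> u v"
  shows "phi G \<pi> ident (ident v) = ident u"
  unfolding phi_def
proof (rule the_equality)
  show "\<exists>w\<in>verts G. \<exists>u'. ident w = ident v \<and> immediately_precedes \<pi> u' w \<and> ident u = ident u'"
    using assms immediately_precedes_verts[OF assms] by blast
  fix j assume "\<exists>w\<in>verts G. \<exists>u'. ident w = ident v \<and> immediately_precedes \<pi> u' w \<and> j = ident u'"
  then obtain w u' where "w \<in> verts G" "ident w = ident v" "immediately_precedes \<pi> u' w" "j = ident u'"
    by blast
  moreover from this have "w = v"
    using identifiers immediately_precedes_verts[OF assms]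
    by (auto simp: identifiers_def dest: inj_onD)
  ultimately show "j = ident u"
    using assms immediately_precedes_unique_left[OF linear] by blast
qed

lemma card_first: "card {v \<in> verts G. \<not> has_pred v} \<le> 1"
proof -
  have "x = y" if "x \<in> verts G" "y \<in> verts G" "\<not> has_pred x" "\<not> has_pred y" for x y
    using precedes_cases[OF linear that(1,2)] that immediately_precedes_exists[OF linear finite_verts]
    unfolding has_pred_def by blast
  then show ?thesis
    using card_le_Suc0_iff_eq[of "{v \<in> verts G. \<not> has_pred v}"] by simp
qed

text \<open>
  The vertices at which \<open>\<phi>\<close> need not continue linearly, each charged to an endpoint, a path, the
  first vertex, or a run. The image of a vertex without a unique arc is junk, which does no harm in an
  upper bound.
\<close>

definition break_candidates :: "'v set" where
  "break_candidates = Ends \<union> (\<lambda>p. head G (hd (snd p))) ` D \<union> (\<lambda>x. head G (out_arc x)) ` Ends \<union>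
     {v \<in> verts G. \<not> has_pred v} \<union> (\<lambda>x. head G (out_arc x)) ` {v \<in> verts G. \<not> has_pred v} \<union>
     (\<lambda>x. head G (out_arc (order_succ x))) ` Ends \<union>
     (\<lambda>p. head G (out_arc (order_succ (tail G (last (snd p)))))) ` D \<union>
     (\<lambda>x. head G (out_arc (order_succ (tail G (in_arc x))))) ` Ends \<union>
     (\<lambda>x. head G (bwt_arcs ! fst x)) ` runs B"

definition breaks :: "'v set" where
  "breaks = verts G \<inter> break_candidates"

lemma break_candidates_subsets:
  "Ends \<subseteq> break_candidates"
  "{v \<in> verts G. \<not> has_pred v} \<subseteq> break_candidates"
  "\<forall>p\<in>D. head G (hd (snd p)) \<in> break_candidates"
  "\<forall>x\<in>Ends. head G (out_arc x) \<in> break_candidates"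
  "\<forall>x\<in>{v \<in> verts G. \<not> has_pred v}. head G (out_arc x) \<in> break_candidates"
  "\<forall>x\<in>Ends. head G (out_arc (order_succ x)) \<in> break_candidates"
  "\<forall>p\<in>D. head G (out_arc (order_succ (tail G (last (snd p))))) \<in> break_candidates"
  "\<forall>x\<in>Ends. head G (out_arc (order_succ (tail G (in_arc x)))) \<in> break_candidates"
  "\<forall>x\<in>runs B. head G (bwt_arcs ! fst x) \<in> break_candidates"
proof -
  have Un_rules: "X \<subseteq> Y \<union> X" "X \<subseteq> Y \<Longrightarrow> X \<subseteq> Y \<union> Z" for X Y Z :: "'v set" by auto
  have "Ends \<subseteq> break_candidates"
    "{v \<in> verts G. \<not> has_pred v} \<subseteq> break_candidates"
    "(\<lambda>p. head G (hd (snd p))) ` D \<subseteq> break_candidates"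
    "(\<lambda>x. head G (out_arc x)) ` Ends \<subseteq> break_candidates"
    "(\<lambda>x. head G (out_arc x)) ` {v \<in> verts G. \<not> has_pred v} \<subseteq> break_candidates"
    "(\<lambda>x. head G (out_arc (order_succ x))) ` Ends \<subseteq> break_candidates"
    "(\<lambda>p. head G (out_arc (order_succ (tail G (last (snd p)))))) ` D \<subseteq> break_candidates"
    "(\<lambda>x. head G (out_arc (order_succ (tail G (in_arc x))))) ` Ends \<subseteq> break_candidates"
    "(\<lambda>x. head G (bwt_arcs ! fst x)) ` runs B \<subseteq> break_candidates"
    unfolding break_candidates_def by (simp_all only: Un_rules order_refl)
  then show "Ends \<subseteq> break_candidates"
    "{v \<in> verts G. \<not> has_pred v} \<subseteq> break_candidates"
    "\<forall>p\<in>D. head G (hd (snd p)) \<in> break_candidates"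
    "\<forall>x\<in>Ends. head G (out_arc x) \<in> break_candidates"
    "\<forall>x\<in>{v \<in> verts G. \<not> has_pred v}. head G (out_arc x) \<in> break_candidates"
    "\<forall>x\<in>Ends. head G (out_arc (order_succ x)) \<in> break_candidates"
    "\<forall>p\<in>D. head G (out_arc (order_succ (tail G (last (snd p))))) \<in> break_candidates"
    "\<forall>x\<in>Ends. head G (out_arc (order_succ (tail G (in_arc x)))) \<in> break_candidates"
    "\<forall>x\<in>runs B. head G (bwt_arcs ! fst x) \<in> break_candidates"
    by (simp_all only: image_subset_iff)
qed

lemma breaks_verts: "breaks \<subseteq> verts G"
  by (simp add: breaks_def)

text \<open>Every exception at \<open>u\<close>, \<open>u'\<close> or \<open>v'\<close> determines
  \<open>v\<close>, through \<open>v = head G (out_arc u)\<close>, \<open>u = order_succ u'\<close>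
  and \<open>u' = tail G (in_arc v')\<close>; the images in \<open>break_candidates\<close> are
  these compositions. Degrees are secured before endpoints are excluded, because the way back needs
  unique arcs.\<close>

lemma phi_continues:
  assumes v: "v \<in> verts G" "v \<notin> breaks"
  obtains u where "u \<in> verts G" "has_pred u" "ident v = Suc (ident u)"
    "phi G \<pi> ident (ident v) = Suc (phi G \<pi> ident (ident u))"
proof -
  define e where "e = in_arc v"
  have nb: "v \<notin> break_candidates" using v by (simp add: breaks_def)
  have nv: "v \<notin> Ends"
    using nb break_candidates_subsets(1) by blast
  have no: "p \<in> D \<Longrightarrow> head G (hd (snd p)) \<noteq> v"
    "x \<in> Ends \<Longrightarrow> head G (out_arc x) \<noteq> v"
    "x \<in> verts G \<Longrightarrow> \<not> has_pred x \<Longrightarrow> head G (out_arc x) \<noteq> v"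
    "x \<in> Ends \<Longrightarrow> head G (out_arc (order_succ x)) \<noteq> v"
    "p \<in> D \<Longrightarrow> head G (out_arc (order_succ (tail G (last (snd p))))) \<noteq> v"
    "x \<in> Ends \<Longrightarrow> head G (out_arc (order_succ (tail G (in_arc x)))) \<noteq> v"
    "a \<in> (\<lambda>x. bwt_arcs ! fst x) ` runs B \<Longrightarrow> head G a \<noteq> v" for p x a
    using nb break_candidates_subsets(3-) by blast+
  note dv = non_endpoint_degrees[OF v(1) nv]
  have e: "e \<in> arcs G" "head G e = v" using in_arc_props[OF v(1) dv(1)] by (auto simp: e_def)
  define u where "u = tail G e"
  have uv: "u \<in> verts G" using e by (simp add: u_def)
  have du: "out_degree G u = 1"
    using tail_internal_or_first[OF e(1)] no(1) e(2) by (auto simp: u_def)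
  have eu: "out_arc u = e" using out_arc_eq[OF e(1)] du by (simp add: u_def)
  have nu: "u \<notin> Ends"
    using no(2) eu e(2) by blast
  have hu: "has_pred u"
    using no(3) eu e(2) uv by blast
  have ident_v: "ident v = Suc (ident u)"
    using compatible e nu nv by (auto simp: compatible_identifiers_def Ends_def u_def)
  obtain u' where u': "immediately_precedes \<pi> u' u" using hu by (auto simp: has_pred_def)
  have su: "order_succ u' = u" using order_succ_eq[OF u'] .
  have uv': "u' \<in> verts G" using immediately_precedes_verts[OF u'] by simp
  have nu': "u' \<notin> Ends"
    using no(4) eu e(2) su by metis
  note du' = non_endpoint_degrees[OF uv' nu']
  define e' where "e' = out_arc u'"
  have e': "e' \<in> arcs G" "tail G e' = u'" using out_arc_props[OF uv' du'(2)] by (auto simp: e'_def)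
  define v' where "v' = head G e'"
  have "in_degree G v' = 1"
  proof -
    have "e' \<noteq> last (snd p)" if "p \<in> D" for p
      using no(5)[OF that] e'(2) su eu e(2) by auto
    then show ?thesis
      using head_internal_or_last[OF e'(1)] by (auto simp: v'_def)
  qed
  then have ev': "in_arc v' = e'" using in_arc_eq[OF e'(1)] by (simp add: v'_def)
  have nv': "v' \<notin> Ends"
    using no(6) ev' e'(2) su eu e(2) by metis
  have ident_v': "ident v' = Suc (ident u')"
    using compatible e' nu' nv' by (auto simp: compatible_identifiers_def Ends_def v'_def)
  have "lab e' = lab e"
  proof (rule ccontr)
    assume "lab e' \<noteq> lab e"
    then have "e \<in> (\<lambda>x. bwt_arcs ! fst x) ` runs B"
      using label_change_starts_run[OF e(1) e'(1)] u' du du' e' by (simp add: u_def)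
    then show False using no(7) e(2) by blast
  qed
  then have "immediately_precedes \<pi> v' v"
    using immediately_precedes_heads[OF e(1) e'(1)] u' du du' dv e' e by (simp add: u_def v'_def)
  then have "phi G \<pi> ident (ident v) = Suc (phi G \<pi> ident (ident u))"
    using phi_ident u' ident_v' by simp
  then show ?thesis using that uv hu ident_v by blast
qed

lemma card_D_pos:
  assumes "verts G \<noteq> {}"
  shows "1 \<le> card D"
proof -
  have "\<forall>v\<in>verts G. \<exists>p\<in>D. v \<in> set (path_verts G p)"
    using decomposition unfolding path_decomposition_def by blast
  then have "D \<noteq> {}" using assms by blast
  then show ?thesis using finite_D by (simp add: Suc_leI card_gt_0_iff)
qed

lemma card_breaks:
  assumes "verts G \<noteq> {}"
  shows "finite breaks" "card breaks \<le> 12 * card D + card (runs B)"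
proof -
  let ?F = "{v \<in> verts G. \<not> has_pred v}"
  have F: "finite ?F" "card ?F \<le> card D"
    using card_first card_D_pos[OF assms] by auto
  show "finite breaks" using finite_subset[OF breaks_verts] by simp
  have im: "card (f ` Ends) \<le> 2 * card D" "card (f ` ?F) \<le> card D" for f :: "'v \<Rightarrow> 'v"
    using card_image_le[OF card_Ends(1), of f] card_Ends(2) card_image_le[OF F(1), of f] F(2) by simp_all
  have un: "card (X \<union> Y) \<le> m + l" if "card X \<le> m" "card Y \<le> l" for X Y :: "'v set" and m l
    using card_Un_le[of X Y] that by simp
  have "breaks \<subseteq> break_candidates" by (simp add: breaks_def break_candidates_def)
  then have "card breaks \<le> card break_candidates"
    unfolding break_candidates_def using finite_D card_Ends finite_runs F
    by (intro card_mono finite_UnI finite_imageI) auto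
  \<comment> \<open>The summands follow the order of the union. There is at most one first vertex,
    and \<open>D\<close> is nonempty, so \<open>card D\<close> covers each set derived from
    it.\<close>
  also have "\<dots> \<le> 2 * card D + card D + 2 * card D + card D + card D + 2 * card D + card D
      + 2 * card D + card (runs B)"
    unfolding break_candidates_def
    by (intro un im F card_Ends card_image_le finite_D finite_runs)
  finally show "card breaks \<le> 12 * card D + card (runs B)" by simp
qed

text \<open>Walking back along arcs lowers the identifier by one at each non-break, so the walk ends
  at a break and passes no other. Having a predecessor in \<pi> is preserved, so \<open>phi\<close>
  is specified all along.\<close>

lemma phi_by_breaks:
  assumes "v \<in> verts G" "has_pred v"
  shows "\<exists>s\<in>ident ` breaks. s \<le> ident v \<and> (\<forall>t\<in>ident ` breaks. t \<le> ident v \<longrightarrow> t \<le> s) \<and>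
    phi G \<pi> ident (ident v) = phi G \<pi> ident s + (ident v - s)"
  using assms
proof (induction "ident v" arbitrary: v rule: less_induct)
  case less
  show ?case
  proof (cases "v \<in> breaks")
    case True
    then show ?thesis by (intro bexI[of _ "ident v"]) auto
  next
    case False
    obtain u where u: "u \<in> verts G" "has_pred u" "ident v = Suc (ident u)"
      "phi G \<pi> ident (ident v) = Suc (phi G \<pi> ident (ident u))"
      using phi_continues[OF less.prems(1) False] by blast
    obtain s where s: "s \<in> ident ` breaks" "s \<le> ident u"
      "\<forall>t\<in>ident ` breaks. t \<le> ident u \<longrightarrow> t \<le> s"
      "phi G \<pi> ident (ident u) = phi G \<pi> ident s + (ident u - s)"
      using less.hyps[OF _ u(1,2)] u(3) by (metis lessI)
    have "t \<le> s" if "t \<in> ident ` breaks" "t \<le> ident v" for t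
    proof -
      have "t \<noteq> ident v"
        using that(1) False less.prems(1) identifiers breaks_verts
        by (auto simp: identifiers_def dest: inj_onD)
      then have "t \<le> ident u" using that(2) u(3) by simp
      then show ?thesis using s(3) that(1) by blast
    qed
    then show ?thesis
      using s u(3,4) by (intro bexI[of _ s]) auto
  qed
qed

end

section \<open>The data structure\<close>

lemma lg_ge_1: "1 \<le> lg n"
proof -
  have "log 2 2 \<le> log 2 (real n + 2)" by (subst log_le_cancel_iff) auto
  then show ?thesis by (simp add: lg_def)
qed

lemma lglg_nonneg: "0 \<le> lglg n"
  using lg_ge_1[of n] by (simp add: lglg_def)

lemma key_length_exists:
  obtains k where "n \<le> 2 ^ k" "real k \<le> lg n + 1"
proof -
  define k where "k = nat \<lceil>lg n\<rceil>"
  have "lg n \<le> real k" "real k \<le> lg n + 1" using lg_ge_1[of n] by (auto simp: k_def)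
  moreover have "real n + 2 = 2 powr lg n" by (simp add: lg_def)
  moreover have "2 powr lg n \<le> 2 powr real k" using calculation by simp
  moreover have "(2::real) powr real k = real (2 ^ k)" by (simp add: powr_realpow)
  ultimately have "real n \<le> real (2 ^ k)" by linarith
  then have "n \<le> 2 ^ k" by (simp only: of_nat_le_iff)
  then show ?thesis using that \<open>real k \<le> lg n + 1\<close> by blast
qed

text \<open>Since \<open>k + 2 \<le> lg n + 3 \<le> 4 * lg n\<close>, the factor 4 adds 2 to the
  logarithm, and rounding up adds 1.\<close>

lemma bisection_depth_exists:
  assumes "real k \<le> lg n + 1"
  obtains e where "k + 2 \<le> 2 ^ e" "real e \<le> lglg n + 3"
proof -
  define e where "e = nat \<lceil>log 2 (real k + 2)\<rceil>"
  have pos: "0 \<le> log 2 (real k + 2)" by simp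
  have e: "log 2 (real k + 2) \<le> real e" "real e \<le> log 2 (real k + 2) + 1"
    using pos by (auto simp: e_def)
  have "real k + 2 = 2 powr log 2 (real k + 2)" by simp
  also have "\<dots> \<le> 2 powr real e" using e(1) by (intro powr_mono) simp_all
  also have "\<dots> = real (2 ^ e)" by (simp add: powr_realpow)
  finally have "real (k + 2) \<le> real (2 ^ e)" by simp
  then have "k + 2 \<le> 2 ^ e" by (simp only: of_nat_le_iff)
  moreover have "log 2 (real k + 2) \<le> log 2 (4 * lg n)"
    using assms lg_ge_1[of n] by (subst log_le_cancel_iff) auto
  moreover have "log 2 (4 * lg n) = 2 + lglg n"
  proof -
    have "log 2 (4::real) = 2" using log_pow_cancel[of 2 2] by simp
    then show ?thesis using lg_ge_1[of n] by (simp add: lglg_def log_mult)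
  qed
  ultimately show ?thesis using that e(2) by force
qed

context decomposed_wheeler_graph
begin

lemma supports_phi_exists:
  assumes nonempty: "verts G \<noteq> {}" and n: "n = card (verts G)" and w: "17 * lg n \<le> real w"
  shows "\<exists>M. supports_phi w phi_program (15808 * real (card (runs B) + card D))
    (15808 * (lglg n + 1)) G \<pi> ident M"
proof -
  obtain k where k: "n \<le> 2 ^ k" "real k \<le> lg n + 1" by (rule key_length_exists)
  obtain e where e: "k + 2 \<le> 2 ^ e" "real e \<le> lglg n + 3" by (rule bisection_depth_exists[OF k(2)])
  \<comment> \<open>The origin of 17: \<open>3 * (lg n + 1) + 11 \<le> 17 * lg n\<close>, as
    \<open>1 \<le> lg n\<close>.\<close>
  have "real (3 * k + 11) \<le> real w" using w k(2) lg_ge_1[of n] by simp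
  then have w': "3 * k + 11 \<le> w" by (simp only: of_nat_le_iff)
  have ident_less: "ident v < 2 ^ k" if "v \<in> verts G" for v
    using identifiers that k(1) n by (auto simp: identifiers_def)
  \<comment> \<open>The sentinel 0 spoils no answer: a vertex with a predecessor in \<pi> has a
    break at or below its identifier, and that break is at least 0.\<close>
  define S where "S = insert 0 (ident ` breaks)"
  define m where "m = card S"
  define s where "s i = sorted_list_of_set S ! i" for i
  have fin: "finite S" using card_breaks(1)[OF nonempty] by (simp add: S_def)
  have "m \<le> Suc (card (ident ` breaks))" unfolding m_def S_def by (rule card_insert_le_m1) simp_all
  moreover have "card (ident ` breaks) \<le> card breaks"
    by (rule card_image_le) (rule card_breaks[OF nonempty])
  ultimately have size: "m \<le> 13 * (card (runs B) + card D)"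
    using card_breaks(2)[OF nonempty] card_D_pos[OF nonempty]
    unfolding distrib_left by linarith
  have len: "length (sorted_list_of_set S) = m" by (simp add: m_def)
  have s_S: "s i \<in> S" if "i < m" for i
    using that fin unfolding s_def by (metis len nth_mem set_sorted_list_of_set)
  have S_s: "\<exists>i<m. s i = t" if "t \<in> S" for t
    using that fin unfolding s_def by (metis len in_set_conv_nth set_sorted_list_of_set)
  have S_bound: "t < 2 ^ k" if "t \<in> S" for t
    using that ident_less breaks_verts by (auto simp: S_def)
  have m_pos: "0 < m" using fin by (auto simp: m_def S_def card_gt_0_iff)
  have s_less: "s i < s j" if "i < j" "j < m" for i j
    using that strict_sorted_list_of_set[of S] len unfolding s_def by (simp add: sorted_wrt_iff_nth_less)
  have "s 0 = 0"
  proof -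
    obtain i where "i < m" "s i = 0" using S_s[of 0] by (auto simp: S_def)
    then show ?thesis using s_less[of 0 i] by (cases "i = 0") auto
  qed
  then interpret sampled_trie k m s
    using m_pos s_less S_bound[OF s_S] by unfold_locales
  \<comment> \<open>At the sentinel or the first vertex \<open>phi\<close> may be unspecified and
    too large for a cell. Where a specified answer depends on it, it is at most that answer and
    hence below \<open>2 ^ k\<close>.\<close>
  define f where "f i = (if phi G \<pi> ident (s i) < 2 ^ k then phi G \<pi> ident (s i) else 0)" for i
  have f_less: "f i < 2 ^ k" for i by (simp add: f_def)
  obtain M where M: "trie_memory k m s w (74 * m + 2) M f" "\<forall>x\<in>set M. x < 2 ^ w"
    using trie_memory_exists[of f, OF f_less w'] by (elim exE conjE) (rule that)
  interpret trie_memory k m s w "74 * m + 2" M f by (rule M(1))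
  \<comment> \<open>Records have 16 cells and there are \<open>74 * m + 2 \<le> 76 * m\<close> of
    them, so the factor is 16 * 76 * 13; the 13 consists of 12 for the breaks and 1 for the
    sentinel.\<close>
  have "length M \<le> 15808 * (card (runs B) + card D)"
    using length_M(1) size m_pos by simp
  then have "real (length M) \<le> real (15808 * (card (runs B) + card D))" by (simp only: of_nat_le_iff)
  then have space: "real (length M) \<le> 15808 * real (card (runs B) + card D)" by simp
  have "\<exists>t y. real t \<le> 15808 * (lglg n + 1) \<and> answers w phi_program M (ident u) t y \<and>
      (has_pred u \<longrightarrow> y = phi G \<pi> ident (ident u))" if u: "u \<in> verts G" for u
  proof -
    obtain t i where t: "t \<le> 40 + 35 * e" "i < m" "s i \<le> ident u" "\<forall>j<m. s j \<le> ident u \<longrightarrow> s j \<le> s i"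
      "answers w phi_program M (ident u) t (f i + (ident u - s i))"
      using query[OF ident_less[OF u] e(1)] by blast
    have "real t \<le> real (40 + 35 * e)" using t(1) by (simp only: of_nat_le_iff)
    also have "\<dots> \<le> 15808 * (lglg n + 1)" using e(2) lglg_nonneg[of n] by simp
    finally have time: "real t \<le> 15808 * (lglg n + 1)" .
    have "f i + (ident u - s i) = phi G \<pi> ident (ident u)" if hp: "has_pred u"
    proof -
      obtain b where b: "b \<in> ident ` breaks" "b \<le> ident u" "\<forall>t\<in>ident ` breaks. t \<le> ident u \<longrightarrow> t \<le> b"
        "phi G \<pi> ident (ident u) = phi G \<pi> ident b + (ident u - b)"
        using phi_by_breaks[OF u hp] by blast
      have "b \<le> s i" using t(4) b(1,2) S_s[of b] by (auto simp: S_def)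
      moreover have "s i \<le> b" using s_S[OF t(2)] b(3) t(3) by (auto simp: S_def)
      ultimately have eq: "s i = b" by simp
      obtain u' where u': "immediately_precedes \<pi> u' u" using hp by (auto simp: has_pred_def)
      have "phi G \<pi> ident (ident u) < 2 ^ k"
        using phi_ident[OF u'] ident_less immediately_precedes_verts[OF u'] by simp
      then show ?thesis using b(4) by (simp add: f_def eq)
    qed
    then show ?thesis using t(5) time by blast
  qed
  then show ?thesis
    using space M(2) unfolding supports_phi_def has_pred_def by blast
qed

end

theorem lemma2:
  shows "\<forall>d::nat. \<exists>\<kappa>\<ge>1::real. \<forall>\<mu>\<ge>\<kappa>. \<exists>(P :: instr list) (C :: real).
    \<forall>(G :: ('v, 'e) pre_digraph) (lab :: 'e \<Rightarrow> 'c::linorder) (\<pi> :: 'v rel) (B :: 'c list)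
      (D :: ('v \<times> 'e list) set) (ident :: 'v \<Rightarrow> nat) (n :: nat) (w :: nat).
      wheeler_graph G lab \<and> wheeler_order G lab \<pi> \<and> is_BWT G lab \<pi> B \<and>
      path_decomposition G D \<and> identifiers G ident \<and> compatible_identifiers G D ident \<and>
      n = card (verts G) \<and> card (arcs G) \<le> d * n ^ d \<and>
      \<kappa> * lg n \<le> real w \<and> real w \<le> \<mu> * lg n \<longrightarrow>
      (\<exists>M. supports_phi w P (C * real (card (runs B) + card D)) (C * (lglg n + 1)) G \<pi> ident M)"
proof (rule allI, rule exI[of _ "17 :: real"], rule conjI, simp, intro allI impI,
    rule exI[of _ phi_program], rule exI[of _ "15808 :: real"], intro allI impI)
  fix d n w :: nat and G :: "('v, 'e) pre_digraph" and lab :: "'e \<Rightarrow> 'c" and \<pi> :: "'v rel"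
    and B :: "'c list" and D :: "('v \<times> 'e list) set" and ident :: "'v \<Rightarrow> nat" and \<mu> :: real
  assume *: "wheeler_graph G lab \<and> wheeler_order G lab \<pi> \<and> is_BWT G lab \<pi> B \<and>
      path_decomposition G D \<and> identifiers G ident \<and> compatible_identifiers G D ident \<and>
      n = card (verts G) \<and> card (arcs G) \<le> d * n ^ d \<and>
      17 * lg n \<le> real w \<and> real w \<le> \<mu> * lg n"
  show "\<exists>M. supports_phi w phi_program (15808 * real (card (runs B) + card D))
    (15808 * (lglg n + 1)) G \<pi> ident M"
  proof (cases "verts G = {}")
    case True
    \<comment> \<open>Without vertices \<open>D\<close> may be empty and the space bound 0, which
      the empty memory meets.\<close>
    then show ?thesis by (intro exI[of _ "[]"]) (simp add: supports_phi_def)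
  next
    case False
    have "fin_digraph G" using * by (simp add: wheeler_graph_def)
    then interpret decomposed_wheeler_graph G lab \<pi> B D ident
      using * by (intro decomposed_wheeler_graph.intro decomposed_wheeler_graph_axioms.intro) auto
    show ?thesis using supports_phi_exists[OF False] * by blast
  qed
qed

end
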